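(* For two agents, there exists a polynomial-time algorithm that solves ExistsUMandEF1, i.e., that, given an allocation instance $(N,O,u)$ with $|N|=2$, decides whether there exists an allocation that is both utilitarian-maximal (UM) and envy-free up to one item (EF1).
   Context: An allocation instance is a tuple $(N,O,u)$ where $N=\{1,\dots,n\}$ is a set of agents, $O=\{o_1,\dots,o_m\}$ is a set of items, and $u$ specifies for each agent $i\in N$ a utility function $u_i:O\to\mathbb{R}_{\ge 0}$ (for computational purposes, non-negative rational numbers encoded in binary). Utilities are additive: $u_i(O')=\sum_{o\in O'}u_i(o)$ for every $O'\subseteq O$. An allocation is a function $p:N\to 2^O$ with $\bigcup_{i\in N}p(i)=O$ and $p(i)\cap p(j)=\emptyset$ for all $i\ne j$. An allocation $p$ is utilitarian-maximal (UM) if it maximizes $\sum_{i\in N}u_i(q(i))$ over all allocations $q$. An allocation $p$ is envy-free up to one item (EF1) if for all $i,j\in N$ there exists a subset $O'\subseteq p(j)$ with $|O'|\le 1$ such that $u_i(p(i))\ge u_i(p(j)\setminus O')$. *)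

theory Defs
  imports Complex_Main "HOL-Library.Log_Nat" "HOL-Computational_Algebra.Polynomial"
begin

section \<open>Allocations of indivisible items\<close>

definition allocation :: "'a set \<Rightarrow> 'i set \<Rightarrow> ('a \<Rightarrow> 'i set) \<Rightarrow> bool" where
  "allocation N Os p \<longleftrightarrow>
     (\<Union>i\<in>N. p i) = Os \<and> (\<forall>i\<in>N. \<forall>j\<in>N. i \<noteq> j \<longrightarrow> p i \<inter> p j = {})"

definition bundle_utility :: "('a \<Rightarrow> 'i \<Rightarrow> real) \<Rightarrow> 'a \<Rightarrow> 'i set \<Rightarrow> real" where
  "bundle_utility u i S = (\<Sum>x\<in>S. u i x)"

definition utilitarian_maximal ::
    "'a set \<Rightarrow> 'i set \<Rightarrow> ('a \<Rightarrow> 'i \<Rightarrow> real) \<Rightarrow> ('a \<Rightarrow> 'i set) \<Rightarrow> bool" where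
  "utilitarian_maximal N Os u p \<longleftrightarrow> allocation N Os p \<and>
     (\<forall>q. allocation N Os q \<longrightarrow>
        (\<Sum>i\<in>N. bundle_utility u i (q i)) \<le> (\<Sum>i\<in>N. bundle_utility u i (p i)))"

definition envy_free_up_to_1 ::
    "'a set \<Rightarrow> ('a \<Rightarrow> 'i \<Rightarrow> real) \<Rightarrow> ('a \<Rightarrow> 'i set) \<Rightarrow> bool" where
  "envy_free_up_to_1 N u p \<longleftrightarrow>
     (\<forall>i\<in>N. \<forall>j\<in>N. \<exists>S\<subseteq>p j. finite S \<and> card S \<le> 1 \<and>
        bundle_utility u i (p i) \<ge> bundle_utility u i (p j - S))"

text \<open>
  Instances as inputs of an algorithm: the agents are \<open>1, \<dots>, num_agents\<close>, the items are
  \<open>1, \<dots>, num_items\<close>, and utilities are rational. The values of \<open>utility\<close> at other arguments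
  carry no meaning and do not enter the encoding.
\<close>

record allocation_instance =
  num_agents :: nat
  num_items :: nat
  utility :: "nat \<Rightarrow> nat \<Rightarrow> rat"

definition agents :: "allocation_instance \<Rightarrow> nat set" where
  "agents I = {1..num_agents I}"

definition items :: "allocation_instance \<Rightarrow> nat set" where
  "items I = {1..num_items I}"

definition real_utility :: "allocation_instance \<Rightarrow> nat \<Rightarrow> nat \<Rightarrow> real" where
  "real_utility I i x = of_rat (utility I i x)"

definition valid_instance :: "allocation_instance \<Rightarrow> bool" where
  "valid_instance I \<longleftrightarrow> (\<forall>i\<in>agents I. \<forall>x\<in>items I. utility I i x \<ge> 0)"

definition exists_UM_and_EF1 :: "allocation_instance \<Rightarrow> bool" where
  "exists_UM_and_EF1 I \<longleftrightarrow>
     (\<exists>p. allocation (agents I) (items I) p \<and>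
          utilitarian_maximal (agents I) (items I) (real_utility I) p \<and>
          envy_free_up_to_1 (agents I) (real_utility I) p)"

section \<open>Binary encoding of instances\<close>

datatype symbol = Zero | One | Sep

text \<open>Most significant digit first; 0 is written as a single digit.\<close>

fun binary :: "nat \<Rightarrow> symbol list" where
  "binary n = (if n < 2 then [] else binary (n div 2)) @ [if even n then Zero else One]"

declare binary.simps [simp del]

definition encode_nat :: "nat \<Rightarrow> symbol list" where
  "encode_nat n = binary n @ [Sep]"

text \<open>A non-negative rational is written in lowest terms, numerator before denominator.\<close>

definition encode_rat :: "rat \<Rightarrow> symbol list" where
  "encode_rat r =
     encode_nat (nat (fst (quotient_of r))) @ encode_nat (nat (snd (quotient_of r)))"

definition encode_instance :: "allocation_instance \<Rightarrow> symbol list" where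
  "encode_instance I =
     encode_nat (num_agents I) @ encode_nat (num_items I) @
     concat [encode_rat (utility I i x). x \<leftarrow> [1..<Suc (num_items I)],
                                         i \<leftarrow> [1..<Suc (num_agents I)]]"

section \<open>Polynomial time on random access machines with logarithmic cost\<close>

text \<open>
  The machine is the random access machine of Cook and Reckhow (Time bounded random access
  machines, 1973), with multiplication added. Registers hold arbitrary integers, and every
  instruction is charged by the binary length of the numbers and computed addresses it
  handles, multiplication by the product of the lengths of its factors (the schoolbook cost).
  With these costs the machine and multitape Turing machines simulate each other with
  polynomial overhead, so the polynomial-time problems are the usual ones.

  The input is read symbol by symbol, from left to right. A negative number that is used as
  an address stands for address 0.
\<close>

datatype instr =
    SetConst nat int      \<comment> \<open>\<open>SetConst i c\<close>: X(i) := c\<close>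
  | Add nat nat nat       \<comment> \<open>\<open>Add i j k\<close>: X(i) := X(j) + X(k)\<close>
  | Sub nat nat nat
  | Mul nat nat nat
  | Load nat nat          \<comment> \<open>\<open>Load i j\<close>: X(i) := X(X(j))\<close>
  | Store nat nat         \<comment> \<open>\<open>Store i j\<close>: X(X(i)) := X(j)\<close>
  | JumpPos nat nat       \<comment> \<open>\<open>JumpPos j l\<close>: go to instruction l if X(j) > 0\<close>
  | Read nat
  | Halt bool             \<comment> \<open>stop and answer yes (\<open>True\<close>) or no (\<open>False\<close>)\<close>

text \<open>Instruction counter, register contents, unread input.\<close>

type_synonym config = "nat \<times> (nat \<Rightarrow> int) \<times> symbol list"

fun symbol_value :: "symbol \<Rightarrow> int" where
  "symbol_value Zero = 0"
| "symbol_value One = 1"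
| "symbol_value Sep = 2"

text \<open>At the end of the input, \<open>Read\<close> yields -1.\<close>

fun next_value :: "symbol list \<Rightarrow> int" where
  "next_value [] = -1"
| "next_value (s # w) = symbol_value s"

fun exec :: "instr \<Rightarrow> config \<Rightarrow> config" where
  "exec (SetConst i c) (pc, X, w) = (Suc pc, X(i := c), w)"
| "exec (Add i j k) (pc, X, w) = (Suc pc, X(i := X j + X k), w)"
| "exec (Sub i j k) (pc, X, w) = (Suc pc, X(i := X j - X k), w)"
| "exec (Mul i j k) (pc, X, w) = (Suc pc, X(i := X j * X k), w)"
| "exec (Load i j) (pc, X, w) = (Suc pc, X(i := X (nat (X j))), w)"
| "exec (Store i j) (pc, X, w) = (Suc pc, X(nat (X i) := X j), w)"
| "exec (JumpPos j l) (pc, X, w) = (if X j > 0 then l else Suc pc, X, w)"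
| "exec (Read i) (pc, X, w) = (Suc pc, X(i := next_value w), tl w)"
| "exec (Halt b) (pc, X, w) = (pc, X, w)"

definition int_length :: "int \<Rightarrow> nat" where
  "int_length z = max 1 (floorlog 2 (nat \<bar>z\<bar>))"

fun cost :: "instr \<Rightarrow> config \<Rightarrow> nat" where
  "cost (SetConst i c) (pc, X, w) = int_length c"
| "cost (Add i j k) (pc, X, w) = int_length (X j) + int_length (X k)"
| "cost (Sub i j k) (pc, X, w) = int_length (X j) + int_length (X k)"
| "cost (Mul i j k) (pc, X, w) = int_length (X j) * int_length (X k)"
| "cost (Load i j) (pc, X, w) = int_length (X j) + int_length (X (nat (X j)))"
| "cost (Store i j) (pc, X, w) = int_length (X i) + int_length (X j)"
| "cost (JumpPos j l) (pc, X, w) = int_length (X j)"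
| "cost (Read i) (pc, X, w) = int_length (next_value w)"
| "cost (Halt b) (pc, X, w) = 1"

text \<open>
  \<open>run P c b t\<close>: started in configuration \<open>c\<close>, the program \<open>P\<close> halts with answer \<open>b\<close>, and
  the total cost of the executed instructions is \<open>t\<close>. A run that leaves the program does not
  halt in this sense.
\<close>

inductive run :: "instr list \<Rightarrow> config \<Rightarrow> bool \<Rightarrow> nat \<Rightarrow> bool" for P :: "instr list" where
  halt: "pc < length P \<Longrightarrow> P ! pc = Halt b \<Longrightarrow> run P (pc, X, w) b (cost (Halt b) (pc, X, w))"
| step: "pc < length P \<Longrightarrow> P ! pc = ins \<Longrightarrow> \<forall>b'. ins \<noteq> Halt b' \<Longrightarrow>
         run P (exec ins (pc, X, w)) b t \<Longrightarrow>
         run P (pc, X, w) b (cost ins (pc, X, w) + t)"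

definition initial_config :: "symbol list \<Rightarrow> config" where
  "initial_config w = (0, \<lambda>_. 0, w)"

text \<open>
  Some program answers the question \<open>Q\<close> correctly on the encoding of every instance in \<open>D\<close>,
  in time polynomial in the length of the encoding.
\<close>

definition polynomial_time_decidable ::
    "('x \<Rightarrow> symbol list) \<Rightarrow> 'x set \<Rightarrow> ('x \<Rightarrow> bool) \<Rightarrow> bool" where
  "polynomial_time_decidable enc D Q \<longleftrightarrow>
     (\<exists>(P :: instr list) (r :: nat poly). \<forall>I\<in>D. \<exists>t.
        run P (initial_config (enc I)) (Q I) t \<and> t \<le> poly r (length (enc I)))"

end

theory Submission imports Defs begin

text \<open>
  An allocation between two agents is utilitarian-maximal iff every item goes to an agent who
  values it most, so only the ties are free. Agent \<open>i\<close> is best off if she gets all ties; write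
  \<open>S\<close> for her utility of her bundle minus her utility of the rest in that case, and \<open>M\<close> for the
  largest utility she has for an item the other agent values strictly more (0 if there is none). Then
  \<open>S + M \<ge> 0\<close> for both agents is necessary. It is also sufficient: hand over the ties one by one,
  starting with all of them at agent 2, until agent 1 is content; the last item handed over is
  the one that agent 2 may disregard.

  \<open>S\<close> and \<open>M\<close> can be accumulated while the items are read, as fractions of integers that have at
  most as many digits as the input read so far. Hence a machine that never addresses
  indirectly suffices, with a linear number of steps of quadratic cost.
\<close>

declare One_nat_def [simp del]

section \<open>Utilitarian-maximal and EF1 allocations for two agents\<close>

text \<open>EF1 of the owner of \<open>P\<close> towards the owner of \<open>Q\<close>: the
  disregarded set is empty or a single item, and its utility stands on the other side, so no set
  difference remains.\<close>

definition envy_free_1 :: "('i \<Rightarrow> real) \<Rightarrow> 'i set \<Rightarrow> 'i set \<Rightarrow> bool" where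
  "envy_free_1 f P Q \<longleftrightarrow> sum f Q \<le> sum f P \<or> (\<exists>x\<in>Q. sum f Q \<le> sum f P + f x)"

lemma envy_free_1_iff:
  assumes "finite Q"
  shows "(\<exists>S\<subseteq>Q. finite S \<and> card S \<le> 1 \<and> sum f (Q - S) \<le> sum f P) \<longleftrightarrow> envy_free_1 f P Q"
proof
  assume "\<exists>S\<subseteq>Q. finite S \<and> card S \<le> 1 \<and> sum f (Q - S) \<le> sum f P"
  then obtain S where S: "S \<subseteq> Q" "finite S" "card S \<le> 1" "sum f (Q - S) \<le> sum f P"
    by blast
  from S(2,3) consider "S = {}" | x where "S = {x}"
    by (metis card_0_eq card_1_singletonE le_eq_less_or_eq less_one)
  then show "envy_free_1 f P Q"
  proof cases
    case 1
    then show ?thesis using S(4) by (simp add: envy_free_1_def)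
  next
    case (2 x)
    then have "x \<in> Q" "sum f Q \<le> sum f P + f x"
      using S assms by (auto simp: sum_diff1)
    then show ?thesis by (auto simp: envy_free_1_def)
  qed
next
  assume "envy_free_1 f P Q"
  then consider "sum f Q \<le> sum f P" | x where "x \<in> Q" "sum f Q \<le> sum f P + f x"
    unfolding envy_free_1_def by blast
  then show "\<exists>S\<subseteq>Q. finite S \<and> card S \<le> 1 \<and> sum f (Q - S) \<le> sum f P"
  proof cases
    case 1
    then show ?thesis by (intro exI[of _ "{}"]) auto
  next
    case (2 x)
    then show ?thesis using assms by (intro exI[of _ "{x}"]) (auto simp: sum_diff1)
  qed
qed

text \<open>Moving a set \<open>R\<close> of items from \<open>Q\<close> to \<open>P\<close> shifts
  the balance by twice \<open>sum f R\<close>. If the disregarded item \<open>x\<close> lies in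
  \<open>R\<close>, then \<open>f x\<close> is at most \<open>sum f R\<close> and no envy is left;
  otherwise \<open>x\<close> still serves.\<close>

lemma envy_free_1_mono:
  assumes "envy_free_1 f P Q" "P \<union> Q = P' \<union> Q'" "P \<inter> Q = {}" "P' \<inter> Q' = {}"
    "finite (P \<union> Q)" "P \<subseteq> P'" "\<And>x. x \<in> P \<union> Q \<Longrightarrow> 0 \<le> f x"
  shows "envy_free_1 f P' Q'"
proof -
  define R where "R = P' - P"
  have fin: "finite P" "finite Q" "finite R" "finite Q'"
    using assms(2,5) unfolding R_def by (metis finite_Un finite_Diff)+
  have P': "P' = P \<union> R" "P \<inter> R = {}" and Q: "Q = Q' \<union> R" "Q' \<inter> R = {}"
    using assms(2-4,6) unfolding R_def by auto
  have sP: "sum f P' = sum f P + sum f R"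
    using P' fin by (simp add: sum.union_disjoint)
  have sQ: "sum f Q = sum f Q' + sum f R"
    using Q fin by (simp add: sum.union_disjoint)
  have nn: "0 \<le> f x" if "x \<in> R" for x
    using that assms(7) Q by blast
  have R0: "0 \<le> sum f R"
    by (rule sum_nonneg) (use nn in auto)
  from assms(1) consider "sum f Q \<le> sum f P" | x where "x \<in> Q" "sum f Q \<le> sum f P + f x"
    unfolding envy_free_1_def by blast
  then show ?thesis
  proof cases
    case 1
    then show ?thesis using sP sQ R0 by (simp add: envy_free_1_def)
  next
    case (2 x)
    show ?thesis
    proof (cases "x \<in> R")
      case True
      then have "f x \<le> sum f R"
        using nn fin by (intro member_le_sum) auto
      then show ?thesis using 2 sP sQ R0 by (simp add: envy_free_1_def)
    next
      case False
      then have "x \<in> Q'" using 2 Q by blast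
      moreover have "sum f Q' \<le> sum f P' + f x" using 2 sP sQ R0 by linarith
      ultimately show ?thesis by (auto simp: envy_free_1_def)
    qed
  qed
qed

text \<open>The chain \<open>sum g P <= sum f P < sum f Q <= sum g Q\<close>. When every item lies
  with an agent who values it most, strict envy is possible on one side only.\<close>

lemma strict_envy_one_sided:
  fixes f g :: "'i \<Rightarrow> real"
  assumes "finite P" "finite Q" "\<And>x. x \<in> P \<Longrightarrow> g x \<le> f x" "\<And>x. x \<in> Q \<Longrightarrow> f x \<le> g x"
    and "sum f P < sum f Q"
  shows "sum g P \<le> sum g Q"
proof -
  have "sum g P \<le> sum f P" "sum f Q \<le> sum g Q"
    using assms(3,4) by (auto intro: sum_mono)
  then show ?thesis using assms(5) by linarith
qed

text \<open>
  Unless she was content before receiving tie \<open>c\<close>, the first agent then strictly envied the other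
  bundle even without \<open>c\<close>; by maximality the other agent does not envy once \<open>c\<close> is disregarded.
\<close>

lemma fair_split_exists:
  fixes f g :: "'i \<Rightarrow> real"
  assumes "finite A" "finite B" "finite C"
    and disj: "A \<inter> B = {}" "A \<inter> C = {}" "B \<inter> C = {}"
    and f_ge: "\<And>x. x \<in> A \<union> C \<Longrightarrow> g x \<le> f x" and g_ge: "\<And>x. x \<in> B \<union> C \<Longrightarrow> f x \<le> g x"
    and "envy_free_1 f (A \<union> C) B" "envy_free_1 g (B \<union> C) A"
  shows "\<exists>D\<subseteq>C. envy_free_1 f (A \<union> D) (B \<union> (C - D)) \<and> envy_free_1 g (B \<union> (C - D)) (A \<union> D)"
proof -
  \<comment> \<open>Read from \<open>D = C\<close> downwards, ties are taken from the first agent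
    one by one. Either she stays content without \<open>c\<close>, or \<open>c\<close> is pivotal
    and \<open>insert c D\<close> is the split wanted; once she holds no ties, the hypothesis on the
    second agent applies.\<close>
  have "D \<subseteq> C \<Longrightarrow> envy_free_1 f (A \<union> D) (B \<union> (C - D)) \<Longrightarrow> ?thesis" if "finite D" for D
    using that
  proof (induction D rule: finite_induct)
    case empty
    then show ?case using assms(10) by (intro exI[of _ "{}"]) auto
  next
    case (insert c D)
    show ?case
    proof (cases "envy_free_1 f (A \<union> D) (B \<union> (C - D))")
      case True
      then show ?thesis using insert by blast
    next
      case False
      let ?Q = "B \<union> (C - insert c D)"
      have c: "c \<in> C" "c \<notin> D" "c \<notin> A" "c \<notin> ?Q"
        using insert disj by auto
      have Q: "B \<union> (C - D) = insert c ?Q"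
        using c by auto
      have sum_Q: "sum f (B \<union> (C - D)) = f c + sum f ?Q"
        unfolding Q using c assms(2,3) by (subst sum.insert) auto
      have "\<not> sum f (B \<union> (C - D)) \<le> sum f (A \<union> D) + f c"
        using False c unfolding envy_free_1_def by blast
      then have "sum f (A \<union> D) < sum f ?Q"
        using sum_Q by linarith
      then have "sum g (A \<union> D) \<le> sum g ?Q"
        using assms(1-3) insert by (intro strict_envy_one_sided[of _ _ g f] f_ge g_ge) auto
      moreover have "sum g (A \<union> insert c D) = g c + sum g (A \<union> D)"
        using c assms(1) insert by simp
      ultimately have "envy_free_1 g ?Q (A \<union> insert c D)"
        unfolding envy_free_1_def by (intro disjI2 bexI[of _ c]) auto
      then show ?thesis using insert by blast
    qed
  qed
  from this[OF assms(3)] show ?thesis using assms(9) by simp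
qed

section \<open>Welfare maximality for two agents, item by item\<close>

definition strictly_better :: "('i \<Rightarrow> real) \<Rightarrow> ('i \<Rightarrow> real) \<Rightarrow> 'i set \<Rightarrow> 'i set" where
  "strictly_better f g Os = {x\<in>Os. g x < f x}"

text \<open>Welfare becomes one term per item, so that allocations can be compared item by item.
  With the negative of \<open>f\<close> in place of \<open>g\<close> it also gives the difference of
  two bundles for one agent.\<close>

lemma welfare_split:
  fixes f g :: "'i \<Rightarrow> real"
  assumes "finite Os" "P \<union> Q = Os" "P \<inter> Q = {}"
  shows "sum f P + sum g Q = (\<Sum>x\<in>Os. if x \<in> P then f x else g x)"
proof -
  have "Os - P = Q" "Os \<inter> P = P" using assms by auto
  then show ?thesis using assms(1) sum.If_cases[of Os "\<lambda>x. x \<in> P" f g]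
    by (simp add: Int_commute Diff_eq Compl_eq)
qed

lemma allocation_two:
  "allocation {1..2} Os p \<longleftrightarrow> p 1 \<union> p 2 = Os \<and> p 1 \<inter> p (2::nat) = {}"
proof -
  have "{1..2::nat} = {1, 2}" by auto
  then show ?thesis by (auto simp: allocation_def)
qed

text \<open>Items contribute independently, so welfare is maximal iff every item contributes the
  larger of its two utilities; a tie may go either way.\<close>

lemma utilitarian_maximal_two:
  fixes u :: "nat \<Rightarrow> 'i \<Rightarrow> real"
  assumes "finite Os"
  shows "utilitarian_maximal {1..2} Os u p \<longleftrightarrow> allocation {1..2} Os p \<and>
    strictly_better (u 1) (u 2) Os \<subseteq> p 1 \<and> strictly_better (u 2) (u 1) Os \<subseteq> p 2"
proof -
  have agents: "{1..2::nat} = {1, 2}" by auto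
  have welfare: "(\<Sum>i\<in>{1..2}. bundle_utility u i (q i)) =
      (\<Sum>x\<in>Os. if x \<in> q 1 then u 1 x else u 2 x)" if "allocation {1..2} Os q" for q
    unfolding agents using that assms
    by (simp add: bundle_utility_def allocation_two welfare_split)
  show ?thesis
  proof (intro iffI conjI)
    assume um: "utilitarian_maximal {1..2} Os u p"
    then show al: "allocation {1..2} Os p"
      by (simp add: utilitarian_maximal_def)
    \<comment> \<open>This comparison allocation attains the maximum at every item; it gives the
      ties to agent 1.\<close>
    define q where "q i = (if i = 1 then {x\<in>Os. u 2 x \<le> u 1 x} else {x\<in>Os. u 1 x < u 2 x})"
      for i :: nat
    have q: "allocation {1..2} Os q"
      unfolding allocation_two q_def by auto
    have "(\<Sum>i\<in>{1..2}. bundle_utility u i (q i)) \<le> (\<Sum>i\<in>{1..2}. bundle_utility u i (p i))"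
      using um q unfolding utilitarian_maximal_def by blast
    then have ge: "(\<Sum>x\<in>Os. if x \<in> q 1 then u 1 x else u 2 x) \<le> (\<Sum>x\<in>Os. if x \<in> p 1 then u 1 x else u 2 x)"
      by (simp only: welfare[OF al] welfare[OF q])
    have le: "(if x \<in> p 1 then u 1 x else u 2 x) \<le> (if x \<in> q 1 then u 1 x else u 2 x)"
      if "x \<in> Os" for x using that by (auto simp: q_def)
    have "(\<Sum>x\<in>Os. if x \<in> p 1 then u 1 x else u 2 x) = (\<Sum>x\<in>Os. if x \<in> q 1 then u 1 x else u 2 x)"
      by (rule antisym[OF sum_mono ge]) (rule le)
    \<comment> \<open>Equal sums with termwise domination force equality of every term.\<close>
    then have eq: "(if x \<in> p 1 then u 1 x else u 2 x) = (if x \<in> q 1 then u 1 x else u 2 x)"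
      if "x \<in> Os" for x
      by (rule sum_mono_inv) (use le that assms in auto)
    have ps: "p 1 \<union> p 2 = Os" using al by (simp add: allocation_two)
    have "x \<in> p 1" if "x \<in> Os" "u 2 x < u 1 x" for x
      using eq[OF that(1)] that by (cases "x \<in> p 1") (simp_all add: q_def)
    then show "strictly_better (u 1) (u 2) Os \<subseteq> p 1"
      by (auto simp: strictly_better_def)
    have "x \<notin> p 1" if "x \<in> Os" "u 1 x < u 2 x" for x
      using eq[OF that(1)] that by (cases "x \<in> p 1") (simp_all add: q_def)
    then show "strictly_better (u 2) (u 1) Os \<subseteq> p 2"
      using ps by (auto simp: strictly_better_def)
  next
    assume *: "allocation {1..2} Os p \<and>
      strictly_better (u 1) (u 2) Os \<subseteq> p 1 \<and> strictly_better (u 2) (u 1) Os \<subseteq> p 2"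
    then have al: "allocation {1..2} Os p" by blast
    have "(if x \<in> q 1 then u 1 x else u 2 x) \<le> (if x \<in> p 1 then u 1 x else u 2 x)"
      if "x \<in> Os" for q x
      using * that by (fastforce simp: strictly_better_def allocation_two)
    then have "(\<Sum>i\<in>{1..2}. bundle_utility u i (q i)) \<le> (\<Sum>i\<in>{1..2}. bundle_utility u i (p i))"
      if "allocation {1..2} Os q" for q
      unfolding welfare[OF that] welfare[OF al] by (rule sum_mono)
    then show "utilitarian_maximal {1..2} Os u p"
      using al by (simp add: utilitarian_maximal_def)
  qed
qed

lemma envy_free_up_to_1_two:
  fixes u :: "nat \<Rightarrow> 'i \<Rightarrow> real"
  assumes "finite (p 1)" "finite (p 2)"
  shows "envy_free_up_to_1 {1..2} u p \<longleftrightarrow>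
    envy_free_1 (u 1) (p 1) (p 2) \<and> envy_free_1 (u 2) (p 2) (p 1)"
proof -
  have "{1..2::nat} = {1, 2}" by auto
  moreover have "\<exists>S\<subseteq>P. finite S \<and> card S \<le> 1 \<and> bundle_utility u i (P - S) \<le> bundle_utility u i P"
    for P i by (rule exI[of _ "{}"]) simp
  ultimately show ?thesis
    using envy_free_1_iff[OF assms(2), of "u 1" "p 1"] envy_free_1_iff[OF assms(1), of "u 2" "p 2"]
    by (simp add: envy_free_up_to_1_def bundle_utility_def)
qed

section \<open>Reduction to the two extreme allocations\<close>

definition content :: "('i \<Rightarrow> real) \<Rightarrow> ('i \<Rightarrow> real) \<Rightarrow> 'i set \<Rightarrow> bool" where
  "content f g Os \<longleftrightarrow> envy_free_1 f (Os - strictly_better g f Os) (strictly_better g f Os)"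

text \<open>Necessity: handing all ties to one agent keeps her content by
  \<open>envy_free_1_mono\<close>, and \<open>content\<close> describes this best case. Sufficiency:
  the best cases of both agents are the hypotheses of \<open>fair_split_exists\<close>, with
  \<open>?C\<close> the set of ties.\<close>

lemma exists_UM_and_EF1_two:
  fixes u :: "nat \<Rightarrow> 'i \<Rightarrow> real"
  assumes fin: "finite Os" and nonneg: "\<And>i x. i \<in> {1..2} \<Longrightarrow> x \<in> Os \<Longrightarrow> 0 \<le> u i x"
  shows "(\<exists>p. allocation {1..2} Os p \<and> utilitarian_maximal {1..2} Os u p \<and>
      envy_free_up_to_1 {1..2} u p) \<longleftrightarrow> content (u 1) (u 2) Os \<and> content (u 2) (u 1) Os"
proof
  assume "\<exists>p. allocation {1..2} Os p \<and> utilitarian_maximal {1..2} Os u p \<and>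
    envy_free_up_to_1 {1..2} u p"
  then obtain p where p: "p 1 \<union> p 2 = Os" "p 1 \<inter> p 2 = {}"
    "strictly_better (u 1) (u 2) Os \<subseteq> p 1" "strictly_better (u 2) (u 1) Os \<subseteq> p 2"
    and ef: "envy_free_up_to_1 {1..2} u p"
    by (auto simp: utilitarian_maximal_two[OF fin] allocation_two)
  have "finite (p 1)" "finite (p 2)" using p(1) fin by auto
  with ef have *: "envy_free_1 (u 1) (p 1) (p 2)" "envy_free_1 (u 2) (p 2) (p 1)"
    by (simp_all add: envy_free_up_to_1_two)
  show "content (u 1) (u 2) Os \<and> content (u 2) (u 1) Os"
    unfolding content_def using p fin nonneg
    by (intro conjI envy_free_1_mono[OF *(1)] envy_free_1_mono[OF *(2)])
      (auto simp: strictly_better_def)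
next
  let ?A = "strictly_better (u 1) (u 2) Os" and ?B = "strictly_better (u 2) (u 1) Os"
    and ?C = "{x\<in>Os. u 1 x = u 2 x}"
  assume "content (u 1) (u 2) Os \<and> content (u 2) (u 1) Os"
  moreover have "Os - ?B = ?A \<union> ?C" "Os - ?A = ?B \<union> ?C"
    by (auto simp: strictly_better_def)
  ultimately have ends: "envy_free_1 (u 1) (?A \<union> ?C) ?B" "envy_free_1 (u 2) (?B \<union> ?C) ?A"
    by (simp_all add: content_def)
  have fins: "finite ?A" "finite ?B" "finite ?C"
    using fin by (auto simp: strictly_better_def)
  have "\<exists>D\<subseteq>?C. envy_free_1 (u 1) (?A \<union> D) (?B \<union> (?C - D)) \<and>
      envy_free_1 (u 2) (?B \<union> (?C - D)) (?A \<union> D)"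
    by (rule fair_split_exists[OF fins _ _ _ _ _ ends]) (auto simp: strictly_better_def)
  then obtain D where D: "D \<subseteq> ?C" "envy_free_1 (u 1) (?A \<union> D) (?B \<union> (?C - D))"
      "envy_free_1 (u 2) (?B \<union> (?C - D)) (?A \<union> D)"
    by blast
  define p where "p i = (if i = 1 then ?A \<union> D else ?B \<union> (?C - D))" for i :: nat
  have "p 1 \<union> p 2 = Os" "p 1 \<inter> p 2 = {}"
    using D(1) by (auto simp: p_def strictly_better_def)
  moreover from this fin have "finite (p 1)" "finite (p 2)" by auto
  ultimately show "\<exists>p. allocation {1..2} Os p \<and> utilitarian_maximal {1..2} Os u p \<and>
      envy_free_up_to_1 {1..2} u p"
    using D by (intro exI[of _ p])
      (auto simp: utilitarian_maximal_two[OF fin] allocation_two envy_free_up_to_1_two p_def)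
qed

text \<open>In the best case the utilities of the own bundle and of the rest differ by
  \<open>S\<close>, since items the other agent values strictly more count negatively. The
  existential asks whether the largest such \<open>f x\<close> lifts \<open>S\<close> to at least 0,
  which is why storing one maximum is enough.\<close>

lemma content_iff:
  fixes f g :: "'i \<Rightarrow> real"
  assumes "finite Os"
  defines "S \<equiv> (\<Sum>x\<in>Os. if f x < g x then - f x else f x)"
  shows "content f g Os \<longleftrightarrow> 0 \<le> S \<or> (\<exists>x\<in>Os. f x < g x \<and> 0 \<le> S + f x)"
proof -
  let ?B = "strictly_better g f Os"
  have "(\<Sum>x\<in>Os - ?B. f x) + (\<Sum>x\<in>?B. - f x) = (\<Sum>x\<in>Os. if x \<in> Os - ?B then f x else - f x)"
    using assms(1) by (intro welfare_split) (auto simp: strictly_better_def)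
  also have "\<dots> = S"
    unfolding S_def by (intro sum.cong) (auto simp: strictly_better_def)
  finally have "S = (\<Sum>x\<in>Os - ?B. f x) + (\<Sum>x\<in>?B. - f x)"
    by simp
  then have "S = sum f (Os - ?B) - sum f ?B"
    by (simp add: sum_negf)
  then show ?thesis
    by (auto simp: content_def envy_free_1_def strictly_better_def algebra_simps)
qed

section \<open>Running time\<close>

text \<open>\<open>reach P t c c'\<close>: some steps of total cost at most \<open>t\<close> lead from \<open>c\<close> to \<open>c'\<close>.\<close>

inductive reach :: "instr list \<Rightarrow> nat \<Rightarrow> config \<Rightarrow> config \<Rightarrow> bool" for P where
  refl: "reach P t c c"
| step: "pc < length P \<Longrightarrow> \<forall>b. P ! pc \<noteq> Halt b \<Longrightarrow> cost (P ! pc) (pc, X, w) \<le> s \<Longrightarrow>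
    reach P t (exec (P ! pc) (pc, X, w)) c' \<Longrightarrow> reach P (s + t) (pc, X, w) c'"

lemma reach_trans: "reach P s c c' \<Longrightarrow> reach P t c' c'' \<Longrightarrow> reach P (s + t) c c''"
proof (induction rule: reach.induct)
  case (refl s c)
  \<comment> \<open>\<open>refl\<close> allows any budget, so the surplus \<open>s\<close> of an
    empty first run is charged to the first step of the second run.\<close>
  have "reach P (s + t) c c''" if "reach P t c c''" for t
    using that
  proof cases
    case (step pc X w s' t')
    then show ?thesis using reach.step[of pc P X w "s + s'" t'] by (simp add: add.assoc)
  qed (simp add: reach.refl)
  then show ?case using refl by simp
next
  case (step pc X w s t c')
  then show ?case using reach.step[of pc P X w s] by (simp add: add.assoc)
qed

lemma reach_mono: "reach P s c c' \<Longrightarrow> s \<le> t \<Longrightarrow> reach P t c c'"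
  using reach_trans[OF reach.refl, of P s c c' "t - s"] by simp

text \<open>\<open>Suc t\<close> pays for the final \<open>Halt\<close>, of cost 1, which
  \<open>reach\<close> stops short of.\<close>

lemma reach_run:
  assumes "reach P t c (pc, X, w)" "pc < length P" "P ! pc = Halt b"
  shows "\<exists>t'\<le>Suc t. run P c b t'"
proof -
  have "\<exists>t'\<le>Suc t. run P c b t'" if "reach P t c c'" "c' = (pc, X, w)" for c'
    using that
  proof (induction rule: reach.induct)
    case (refl t c)
    then show ?case using run.halt[OF assms(2,3), of X w] by (intro exI[of _ 1]) simp
  next
    case (step pc' X' w' s t c')
    then obtain t' where "t' \<le> Suc t" "run P (exec (P ! pc') (pc', X', w')) b t'" by blast
    with step.hyps show ?case
      using run.step[of pc' P "P ! pc'" X' w' b t']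
      by (intro exI[of _ "cost (P ! pc') (pc', X', w') + t'"]) auto
  qed
  with assms(1) show ?thesis by blast
qed

section \<open>Program fragments and the size of numbers\<close>

fun code_at :: "instr list \<Rightarrow> nat \<Rightarrow> instr list \<Rightarrow> bool" where
  "code_at P k [] \<longleftrightarrow> True"
| "code_at P k (i # c) \<longleftrightarrow> k < length P \<and> P ! k = i \<and> code_at P (Suc k) c"

lemma code_at_append: "code_at P k (c @ d) \<longleftrightarrow> code_at P k c \<and> code_at P (k + length c) d"
  by (induction c arbitrary: k) auto

lemma code_at_self: "code_at P 0 P"
proof -
  have "code_at (xs @ c) (length xs) c" for xs c
  proof (induction c arbitrary: xs)
    case (Cons i c)
    show ?case using Cons[of "xs @ [i]"] by simp
  qed simp
  from this[of "[]"] show ?thesis by simp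
qed

lemma int_length_le:
  assumes "\<bar>z\<bar> < 2 ^ K" "0 < K"
  shows "int_length z \<le> K"
proof -
  have "nat \<bar>z\<bar> < 2 ^ K" using assms(1) by (simp add: nat_less_iff)
  then have "floorlog 2 (nat \<bar>z\<bar>) \<le> K" by (simp add: floorlog_le_iff)
  then show ?thesis using assms(2) by (simp add: int_length_def)
qed

text \<open>Below \<open>2 ^ K\<close> a number has at most \<open>K\<close> digits, so
  \<open>K * K\<close> bounds the cost of every kind of instruction in use: products of lengths
  directly, sums because \<open>2 <= K\<close>. Bounding time then amounts to counting
  steps.\<close>

lemma cost_le:
  assumes "2 \<le> K" "\<bar>y\<bar> < 2 ^ K"
  shows "int_length y \<le> K * K"
    and "\<bar>z\<bar> < 2 ^ K \<Longrightarrow> int_length y + int_length z \<le> K * K"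
    and "\<bar>z\<bar> < 2 ^ K \<Longrightarrow> int_length y * int_length z \<le> K * K"
proof -
  have y: "int_length y \<le> K" using assms by (intro int_length_le) auto
  have "2 * K \<le> K * K" using assms(1) by (rule mult_le_mono1)
  then have KK: "K + K \<le> K * K" by linarith
  show "int_length y \<le> K * K" using y KK by linarith
  assume "\<bar>z\<bar> < 2 ^ K"
  then have z: "int_length z \<le> K" using assms by (intro int_length_le) auto
  show "int_length y + int_length z \<le> K * K" using y z KK by linarith
  show "int_length y * int_length z \<le> K * K" using y z by (rule mult_le_mono)
qed

text \<open>\<open>2 * L + 2\<close> digits suffice for intermediate results: with factors up to
  \<open>t = 2 ^ L\<close>, two products plus 1 stay below \<open>4 * (t * t)\<close>.\<close>

lemma power_bounds:
  fixes K L :: nat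
  assumes "2 * L + 2 \<le> K"
  shows "(2 :: int) ^ L < 2 ^ K" "(2 :: int) ^ L * 2 ^ L < 2 ^ K"
    "(2 :: int) ^ L * 2 ^ L + 2 ^ L * 2 ^ L + 1 < 2 ^ K"
proof -
  have *: "t < M" "t * t < M" "t * t + t * t + 1 < M"
    if "4 * (t * t) \<le> M" "1 \<le> t" "t \<le> t * t" for t M :: int
    using that by linarith+
  have "(2 :: int) ^ (2 * L + 2) = 4 * (2 ^ L * 2 ^ L)"
    by (simp add: power_add power_mult power_mult_distrib[symmetric])
  moreover have "(2 :: int) ^ (2 * L + 2) \<le> 2 ^ K"
    by (rule power_increasing[OF assms]) simp
  ultimately have 1: "4 * (2 ^ L * 2 ^ L) \<le> (2 :: int) ^ K"
    by (simp only:)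
  have 2: "1 \<le> (2 :: int) ^ L"
    by (rule one_le_power) simp
  have 3: "(2 :: int) ^ L \<le> 2 ^ L * 2 ^ L"
    using mult_left_mono[OF 2, of "2 ^ L"] by (simp only: mult_1_right zero_le_power zero_le_numeral)
  show "(2 :: int) ^ L < 2 ^ K" "(2 :: int) ^ L * 2 ^ L < 2 ^ K"
    "(2 :: int) ^ L * 2 ^ L + 2 ^ L * 2 ^ L + 1 < 2 ^ K"
    by (rule *[OF 1 2 3])+
qed

definition fits :: "nat \<Rightarrow> int \<Rightarrow> bool" where
  "fits K z \<longleftrightarrow> \<bar>z\<bar> < 2 ^ K"

lemma fits_small:
  assumes "2 \<le> K" "\<bar>z\<bar> \<le> 3"
  shows "fits K z"
proof -
  have "(2 :: int) ^ 2 \<le> 2 ^ K" by (rule power_increasing[OF assms(1)]) simp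
  moreover have "\<bar>z\<bar> < 2 ^ 2" using assms(2) by simp
  ultimately show ?thesis unfolding fits_def by (rule order.strict_trans2[rotated])
qed

lemma
  fixes K L :: nat and x y z t :: int
  assumes K: "2 * L + 2 \<le> K"
  shows fits_le: "\<bar>x\<bar> \<le> 2 ^ L \<Longrightarrow> fits K x"
    and fits_mult: "\<bar>x\<bar> \<le> 2 ^ L \<Longrightarrow> \<bar>y\<bar> \<le> 2 ^ L \<Longrightarrow> fits K (x * y)"
    and fits_mult_add: "\<bar>x\<bar> \<le> 2 ^ L \<Longrightarrow> \<bar>y\<bar> \<le> 2 ^ L \<Longrightarrow> \<bar>z\<bar> \<le> 2 ^ L \<Longrightarrow> \<bar>t\<bar> \<le> 2 ^ L \<Longrightarrow>
      fits K (x * y + z * t) \<and> fits K (x * y + z * t + 1) \<and> fits K (x * y - z * t)"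
proof -
  have prod: "\<bar>x * y\<bar> \<le> 2 ^ L * 2 ^ L" if "\<bar>x\<bar> \<le> 2 ^ L" "\<bar>y\<bar> \<le> 2 ^ L" for x y :: int
    unfolding abs_mult using that by (rule mult_mono) simp_all
  note pb = power_bounds[OF K]
  show "\<bar>x\<bar> \<le> 2 ^ L \<Longrightarrow> fits K x"
    unfolding fits_def using pb(1) by (rule order.strict_trans1[rotated])
  show "fits K (x * y)" if "\<bar>x\<bar> \<le> 2 ^ L" "\<bar>y\<bar> \<le> 2 ^ L"
    unfolding fits_def using prod[OF that] pb(2) by (rule order.strict_trans1)
  have *: "\<bar>a + b\<bar> < M \<and> \<bar>a + b + 1\<bar> < M \<and> \<bar>a - b\<bar> < M" if "\<bar>a\<bar> \<le> m" "\<bar>b\<bar> \<le> m" "m + m + 1 < M"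
    for a b m M :: int
    using that by linarith
  show "fits K (x * y + z * t) \<and> fits K (x * y + z * t + 1) \<and> fits K (x * y - z * t)"
    if "\<bar>x\<bar> \<le> 2 ^ L" "\<bar>y\<bar> \<le> 2 ^ L" "\<bar>z\<bar> \<le> 2 ^ L" "\<bar>t\<bar> \<le> 2 ^ L"
    unfolding fits_def using prod[OF that(1,2)] prod[OF that(3,4)] pb(3) by (rule *)
qed

section \<open>Single instructions at uniform cost\<close>

lemma reach_straight:
  assumes "pc < length P \<and> P ! pc = ins" "\<forall>b. ins \<noteq> Halt b" "cost ins (pc, X, w) \<le> s"
    "reach P t (exec ins (pc, X, w)) c'"
  shows "reach P (s + t) (pc, X, w) c'"
  using assms by (intro reach.step) simp_all

context
  fixes P :: "instr list" and K :: nat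
  assumes K: "2 \<le> K"
begin

lemma reach_SetConst:
  assumes "pc < length P \<and> P ! pc = SetConst i c" "fits K c"
    "reach P t (Suc pc, X(i := c), w) c'"
  shows "reach P (K * K + t) (pc, X, w) c'"
  using assms K by (intro reach_straight[OF assms(1)]) (simp_all add: fits_def cost_le)

text \<open>The equations for the operands make a symbolic run record its results as expressions in
  known values instead of register lookups.\<close>

lemma reach_Add:
  assumes "pc < length P \<and> P ! pc = Add i j k" "X j = y" "X k = z" "fits K y" "fits K z"
    "reach P t (Suc pc, X(i := y + z), w) c'"
  shows "reach P (K * K + t) (pc, X, w) c'"
  using assms K by (intro reach_straight[OF assms(1)]) (simp_all add: fits_def cost_le)

lemma reach_Sub:
  assumes "pc < length P \<and> P ! pc = Sub i j k" "X j = y" "X k = z" "fits K y" "fits K z"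
    "reach P t (Suc pc, X(i := y - z), w) c'"
  shows "reach P (K * K + t) (pc, X, w) c'"
  using assms K by (intro reach_straight[OF assms(1)]) (simp_all add: fits_def cost_le)

lemma reach_Mul:
  assumes "pc < length P \<and> P ! pc = Mul i j k" "X j = y" "X k = z" "fits K y" "fits K z"
    "reach P t (Suc pc, X(i := y * z), w) c'"
  shows "reach P (K * K + t) (pc, X, w) c'"
  using assms K by (intro reach_straight[OF assms(1)]) (simp_all add: fits_def cost_le)

lemma reach_jump:
  assumes "pc < length P \<and> P ! pc = JumpPos j l" "X j = y" "fits K y" "0 < y"
    "reach P t (l, X, w) c'"
  shows "reach P (K * K + t) (pc, X, w) c'"
  using assms K by (intro reach_straight[OF assms(1)]) (simp_all add: fits_def cost_le)

lemma reach_no_jump: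
  assumes "pc < length P \<and> P ! pc = JumpPos j l" "X j = y" "fits K y" "y \<le> 0"
    "reach P t (Suc pc, X, w) c'"
  shows "reach P (K * K + t) (pc, X, w) c'"
  using assms K by (intro reach_straight[OF assms(1)]) (simp_all add: fits_def cost_le)

lemma reach_Read:
  assumes "pc < length P \<and> P ! pc = Read i" "reach P t (Suc pc, X(i := symbol_value s), w) c'"
  shows "reach P (K * K + t) (pc, X, s # w) c'"
proof -
  have "\<bar>symbol_value s\<bar> \<le> 3"
    by (cases s) auto
  then have "fits K (symbol_value s)" by (rule fits_small[OF K])
  then show ?thesis
    using assms K by (intro reach_straight[OF assms(1)]) (simp_all add: fits_def cost_le)
qed

end

section \<open>Reading numbers\<close>

text \<open>
  Registers 0 and 1 hold the constants 0 and 1, registers 2 and 3 are scratch. Among the symbol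
  values only that of the separator stays positive when 1 is subtracted.
\<close>

definition read_number :: "nat \<Rightarrow> nat \<Rightarrow> instr list" where
  "read_number k r = [SetConst r 0, Read 2, Sub 3 2 1, JumpPos 3 (k + 7),
     Add r r r, Add r r 2, JumpPos 1 (Suc k)]"

fun horner :: "int \<Rightarrow> symbol list \<Rightarrow> int" where
  "horner z [] = z"
| "horner z (s # xs) = horner (2 * z + symbol_value s) xs"

lemma horner_append: "horner z (xs @ ys) = horner (horner z xs) ys"
  by (induction xs arbitrary: z) auto

lemma Sep_notin_binary: "Sep \<notin> set (binary n)"
proof (induction n rule: binary.induct)
  case (1 n)
  then show ?case by (subst binary.simps) auto
qed

lemma horner_binary: "horner 0 (binary n) = int n"
proof (induction n rule: binary.induct)
  case (1 n)
  then show ?case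
    by (subst binary.simps) (auto simp: horner_append elim!: evenE oddE)
qed

lemma less_power_length_binary: "n < 2 ^ length (binary n)"
proof (induction n rule: binary.induct)
  case (1 n)
  then show ?case
    by (subst binary.simps) auto
qed

text \<open>The bound on \<open>(X r + 1) * 2 ^ length xs\<close> is invariant: a digit
  \<open>s\<close> is at most 1, so \<open>2 * z + s + 1 <= 2 * (z + 1)\<close>. It keeps the
  accumulator within \<open>2 ^ L\<close>. A digit takes 6 instructions, the separator 3. The loop
  starts at \<open>Suc k\<close>, after the reset of \<open>r\<close>.\<close>

lemma reach_read_loop:
  assumes K: "2 * L + 2 \<le> K" and code: "code_at P k (read_number k r)" and r: "3 < r"
  assumes "Sep \<notin> set xs" "X 1 = 1" "0 \<le> X r" "(X r + 1) * 2 ^ length xs \<le> 2 ^ L"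
  shows "\<exists>X'. reach P ((6 * length xs + 3) * (K * K)) (Suc k, X, xs @ Sep # w) (k + 7, X', w) \<and>
    X' r = horner (X r) xs \<and> (\<forall>q. q \<notin> {2, 3, r} \<longrightarrow> X' q = X q)"
  using assms(4-)
proof (induction xs arbitrary: X)
  have K2: "2 \<le> K" using K by simp
  note fits_small[OF K2, simp]
  note code[unfolded read_number_def, simplified, simp]
  have [simp]: "r \<noteq> 1" "r \<noteq> 2" "r \<noteq> 3" "1 \<noteq> r" "2 \<noteq> r" "3 \<noteq> r" using r by linarith+
  {
    case Nil
    have "reach P (K * K + (K * K + (K * K + 0))) (Suc k, X, Sep # w) (k + 7, X(2 := 2, 3 := 1), w)"
      apply (rule reach_Read[OF K2], simp)
      apply (rule reach_Sub[OF K2], simp, simp, simp add: Nil, simp, simp)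
      apply (rule reach_jump[OF K2], simp, simp, simp, simp)
      apply (simp add: reach.refl)
      done
    moreover have "K * K + (K * K + (K * K + 0)) = (6 * length ([] :: symbol list) + 3) * (K * K)"
      by simp
    ultimately have R: "reach P ((6 * length ([] :: symbol list) + 3) * (K * K))
        (Suc k, X, Sep # w) (k + 7, X(2 := 2, 3 := 1), w)"
      by (simp only:)
    have "X(2 := 2, 3 := 1) = X' \<Longrightarrow> X' r = horner (X r) [] \<and> (\<forall>q. q \<notin> {2, 3, r} \<longrightarrow> X' q = X q)" for X'
      by auto
    with R show ?case by auto
  next
    case (Cons s xs)
    let ?z = "2 * X r + symbol_value s"
    have s: "0 \<le> symbol_value s" "symbol_value s \<le> 1" using Cons.prems by (cases s; simp)+
    have [simp]: "fits K (symbol_value s)" "fits K (symbol_value s - 1)"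
      using s by (auto intro!: fits_small[OF K2])
    have pos: "1 \<le> (2 :: int) ^ length xs" by (rule one_le_power) simp
    have "(?z + 1) * 2 ^ length xs \<le> (2 * X r + 2) * 2 ^ length xs"
      using s by (intro mult_right_mono) simp_all
    also have "\<dots> = (X r + 1) * 2 ^ length (s # xs)"
      by (simp add: algebra_simps)
    finally have le: "(?z + 1) * 2 ^ length xs \<le> 2 ^ L"
      using Cons.prems(4) by (rule order_trans)
    have "?z + 1 \<le> (?z + 1) * 2 ^ length xs"
      using mult_left_mono[OF pos, of "?z + 1"] Cons.prems(3) s by simp
    then have "?z + 1 \<le> 2 ^ L"
      using le by (rule order_trans)
    then have "\<bar>X r\<bar> \<le> 2 ^ L" "\<bar>2 * X r\<bar> \<le> 2 ^ L"
      using Cons.prems(3) s by (auto simp del: power_le_zero_eq)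
    then have fits [simp]: "fits K (X r)" "fits K (2 * X r)"
      by (auto intro: fits_le[OF K])
    let ?X = "X(2 := symbol_value s, 3 := symbol_value s - 1, r := ?z)"
    have "\<exists>X'. reach P ((6 * length xs + 3) * (K * K)) (Suc k, ?X, xs @ Sep # w) (k + 7, X', w) \<and>
        X' r = horner (?X r) xs \<and> (\<forall>q. q \<notin> {2, 3, r} \<longrightarrow> X' q = ?X q)"
      using Cons.prems s r le by (intro Cons.IH) simp_all
    then obtain X' where X': "reach P ((6 * length xs + 3) * (K * K)) (Suc k, ?X, xs @ Sep # w) (k + 7, X', w)"
      "X' r = horner ?z xs" "\<forall>q. q \<notin> {2, 3, r} \<longrightarrow> X' q = ?X q"
      by auto
    have X_eq: "X(2 := symbol_value s, 3 := symbol_value s - 1, r := X r + X r, r := 2 * X r + symbol_value s) = ?X"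
      by auto
    have "reach P (K * K + (K * K + (K * K + (K * K + (K * K + (K * K + 0))))))
        (Suc k, X, (s # xs) @ Sep # w) (Suc k, ?X, xs @ Sep # w)"
      apply (simp only: append_Cons)
      apply (rule reach_Read[OF K2], simp)
      apply (rule reach_Sub[OF K2], simp, simp, simp add: Cons.prems, simp, simp)
      apply (rule reach_no_jump[OF K2], simp, simp, simp, simp add: s)
      apply (rule reach_Add[OF K2], simp, simp, simp, simp, simp)
      apply (rule reach_Add[OF K2], simp, simp, simp, simp, simp)
      apply (rule reach_jump[OF K2], simp, simp add: Cons.prems, simp, simp)
      apply (simp add: X_eq reach.refl)
      done
    from reach_trans[OF this X'(1)] show ?case
      using X' by (intro exI[of _ X']) (auto simp: algebra_simps)
  }
qed

text \<open>The 6 steps budgeted for the separator cover the reset of \<open>r\<close> and the 3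
  steps that leave the loop.\<close>

lemma reach_read_number:
  assumes K: "2 * L + 2 \<le> K" and code: "code_at P k (read_number k r)" and r: "3 < r"
  assumes "X 1 = 1" "length (encode_nat n) \<le> L"
  shows "\<exists>X'. reach P (6 * length (encode_nat n) * (K * K)) (k, X, encode_nat n @ w) (k + 7, X', w) \<and>
    X' r = int n \<and> (\<forall>q. q \<notin> {2, 3, r} \<longrightarrow> X' q = X q)"
proof -
  have K2: "2 \<le> K" using K by simp
  have "(2::int) ^ length (binary n) \<le> 2 ^ L"
    using assms(5) by (intro power_increasing) (auto simp: encode_nat_def)
  then obtain X' where X': "reach P ((6 * length (binary n) + 3) * (K * K))
      (Suc k, X(r := 0), binary n @ Sep # w) (k + 7, X', w)"
    "X' r = horner 0 (binary n)" "\<forall>q. q \<notin> {2, 3, r} \<longrightarrow> X' q = (X(r := 0)) q"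
    using reach_read_loop[OF K code r Sep_notin_binary, of "X(r := 0)" n w] assms r by auto
  have "reach P (K * K + (6 * length (binary n) + 3) * (K * K)) (k, X, encode_nat n @ w) (k + 7, X', w)"
    by (rule reach_SetConst[OF K2]) (use X' code in \<open>auto simp: read_number_def encode_nat_def fits_small[OF K2]\<close>)
  then have "reach P (6 * length (encode_nat n) * (K * K)) (k, X, encode_nat n @ w) (k + 7, X', w)"
    by (rule reach_mono) (auto simp: encode_nat_def algebra_simps)
  then show ?thesis using X' by (auto simp: horner_binary)
qed

section \<open>Processing one item\<close>

text \<open>
  The registers from \<open>\<rho>\<close> on are: numerator and denominator of \<open>S\<close>, of \<open>M\<close>, and of the utility of the
  current item, and finally a number that is positive iff the other agent values the item
  strictly more.
\<close>

definition update_agent :: "nat \<Rightarrow> nat \<Rightarrow> instr list" where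
  "update_agent k \<rho> = [Mul 3 (\<rho> + 4) (\<rho> + 1), Mul \<rho> \<rho> (\<rho> + 5), Mul (\<rho> + 1) (\<rho> + 1) (\<rho> + 5),
     JumpPos (\<rho> + 6) (k + 6), Add \<rho> \<rho> 3, JumpPos 1 (k + 13), Sub \<rho> \<rho> 3,
     Mul 3 (\<rho> + 4) (\<rho> + 3), Mul 2 (\<rho> + 2) (\<rho> + 5), Sub 3 2 3, JumpPos 3 (k + 13),
     Add (\<rho> + 2) (\<rho> + 4) 0, Add (\<rho> + 3) (\<rho> + 5) 0]"

text \<open>All jumps go forward, so the length 13 of the code bounds the number of steps. Adding
  register 0 copies a value. If \<open>n / d\<close> and \<open>a / b\<close> are equal, the stored
  fraction is overwritten by one of the same value.\<close>

lemma reach_update_agent: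
  assumes K: "2 * L + 2 \<le> K" and code: "code_at P k (update_agent k \<rho>)" and \<rho>: "5 \<le> \<rho>"
    and X [simp]: "X 0 = 0" "X 1 = 1" "X \<rho> = N" "X (\<rho> + 1) = D" "X (\<rho> + 2) = a" "X (\<rho> + 3) = b"
      "X (\<rho> + 4) = n" "X (\<rho> + 5) = d" "X (\<rho> + 6) = c"
    and bounds: "\<bar>N\<bar> \<le> 2 ^ L" "\<bar>D\<bar> \<le> 2 ^ L" "\<bar>a\<bar> \<le> 2 ^ L" "\<bar>b\<bar> \<le> 2 ^ L" "\<bar>n\<bar> \<le> 2 ^ L" "\<bar>d\<bar> \<le> 2 ^ L"
      "fits K c"
  shows "\<exists>X'. reach P (13 * (K * K)) (k, X, w) (k + 13, X', w) \<and>
    X' \<rho> = (if 0 < c then N * d - n * D else N * d + n * D) \<and> X' (\<rho> + 1) = D * d \<and>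
    X' (\<rho> + 2) = (if 0 < c \<and> a * d \<le> n * b then n else a) \<and>
    X' (\<rho> + 3) = (if 0 < c \<and> a * d \<le> n * b then d else b) \<and>
    (\<forall>q. q \<notin> {2, 3, \<rho>, \<rho> + 1, \<rho> + 2, \<rho> + 3} \<longrightarrow> X' q = X q)"
proof -
  note add_2_eq_Suc' [simp del]
  have K2: "2 \<le> K" using K by simp
  have [simp]: "\<rho> \<noteq> 0" "\<rho> \<noteq> 1" "\<rho> \<noteq> 2" "\<rho> \<noteq> 3" "0 \<noteq> \<rho>" "1 \<noteq> \<rho>" "2 \<noteq> \<rho>" "3 \<noteq> \<rho>"
    "\<rho> + 1 \<noteq> 0" "\<rho> + 1 \<noteq> 2" "\<rho> + 1 \<noteq> 3" "\<rho> + 2 \<noteq> 3" "\<rho> + 3 \<noteq> 2"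
    using \<rho> by linarith+
  have [simp]: "k + 6 = Suc (Suc (Suc (Suc (Suc (Suc k)))))"
    "k + 13 = Suc (Suc (Suc (Suc (Suc (Suc (Suc (Suc (Suc (Suc (Suc (Suc (Suc k))))))))))))"
    by simp_all
  note code[unfolded update_agent_def, simplified, simp]
  have [simp]: "fits K N" "fits K D" "fits K a" "fits K b" "fits K n" "fits K d" "fits K 0" "fits K 1"
    "fits K (n * D)" "fits K (N * d)" "fits K (n * b)" "fits K (a * d)" "fits K (a * d - n * b)"
    using bounds by (auto intro: fits_le[OF K] fits_mult[OF K] fits_small[OF K2]
      fits_mult_add[OF K, THEN conjunct2, THEN conjunct2])
  note [simp] = \<open>fits K c\<close>
  \<comment> \<open>The three paths through the code: the other agent does not value the item
    strictly more; she does and the stored maximum stays; she does and it is replaced.\<close>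
  consider "c \<le> 0" | "0 < c" "n * b < a * d" | "0 < c" "a * d \<le> n * b" by linarith
  then show ?thesis
  proof cases
    case 1
    show ?thesis
      apply (rule exI, rule conjI, rule reach_mono)
      apply (rule reach_Mul[OF K2], simp, simp, simp, simp, simp)
      apply (rule reach_Mul[OF K2], simp, simp, simp, simp, simp)
      apply (rule reach_Mul[OF K2], simp, simp, simp, simp, simp)
      apply (rule reach_no_jump[OF K2], simp, simp, simp, simp add: 1)
      apply (rule reach_Add[OF K2], simp, simp, simp, simp, simp)
      apply (rule reach_jump[OF K2], simp, simp, simp, simp)
      apply (simp, rule reach.refl[of P 0])
      using 1 apply simp_all
      done
  next
    case 2
    show ?thesis
      apply (rule exI, rule conjI, rule reach_mono)
      apply (rule reach_Mul[OF K2], simp, simp, simp, simp, simp)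
      apply (rule reach_Mul[OF K2], simp, simp, simp, simp, simp)
      apply (rule reach_Mul[OF K2], simp, simp, simp, simp, simp)
      apply (rule reach_jump[OF K2], simp, simp, simp, simp add: 2)
      apply (rule reach_Sub[OF K2], simp, simp, simp, simp, simp)
      apply (rule reach_Mul[OF K2], simp, simp, simp, simp, simp)
      apply (rule reach_Mul[OF K2], simp, simp, simp, simp, simp)
      apply (rule reach_Sub[OF K2], simp, simp, simp, simp, simp)
      apply (rule reach_jump[OF K2], simp, simp, simp, simp add: 2)
      apply (simp, rule reach.refl[of P 0])
      using 2 apply simp_all
      done
  next
    case 3
    show ?thesis
      apply (rule exI, rule conjI, rule reach_mono)
      apply (rule reach_Mul[OF K2], simp, simp, simp, simp, simp)
      apply (rule reach_Mul[OF K2], simp, simp, simp, simp, simp)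
      apply (rule reach_Mul[OF K2], simp, simp, simp, simp, simp)
      apply (rule reach_jump[OF K2], simp, simp, simp, simp add: 3)
      apply (rule reach_Sub[OF K2], simp, simp, simp, simp, simp)
      apply (rule reach_Mul[OF K2], simp, simp, simp, simp, simp)
      apply (rule reach_Mul[OF K2], simp, simp, simp, simp, simp)
      apply (rule reach_Sub[OF K2], simp, simp, simp, simp, simp)
      apply (rule reach_no_jump[OF K2], simp, simp, simp, simp add: 3)
      apply (rule reach_Add[OF K2], simp, simp, simp, simp, simp)
      apply (rule reach_Add[OF K2], simp, simp, simp, simp, simp)
      apply (simp, rule reach.refl[of P 0])
      using 3 apply simp_all
      done
  qed
qed

section \<open>The final test of an agent\<close>

definition check_agent :: "nat \<Rightarrow> nat \<Rightarrow> instr list" where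
  "check_agent k \<rho> = [Mul 2 \<rho> (\<rho> + 3), Mul 3 (\<rho> + 2) (\<rho> + 1), Add 2 2 3, Add 2 2 1,
     JumpPos 2 (k + 6), Halt False]"

text \<open>Jumps test strict positivity, and for an integer \<open>0 <= z\<close> is
  \<open>0 < z + 1\<close>, whence the added constant 1. The number tested is
  \<open>N / D + a / b\<close> with denominators cleared; on failure the machine stands at
  \<open>Halt False\<close>.\<close>

lemma reach_check_agent:
  assumes K: "2 * L + 2 \<le> K" and code: "code_at P k (check_agent k \<rho>)" and \<rho>: "5 \<le> \<rho>"
    and X [simp]: "X 1 = 1" "X \<rho> = N" "X (\<rho> + 1) = D" "X (\<rho> + 2) = a" "X (\<rho> + 3) = b"
    and bounds: "\<bar>N\<bar> \<le> 2 ^ L" "\<bar>D\<bar> \<le> 2 ^ L" "\<bar>a\<bar> \<le> 2 ^ L" "\<bar>b\<bar> \<le> 2 ^ L"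
  shows "\<exists>X'. reach P (5 * (K * K)) (k, X, w) (if 0 \<le> N * b + a * D then k + 6 else k + 5, X', w) \<and>
    (\<forall>q. q \<notin> {2, 3} \<longrightarrow> X' q = X q)"
proof -
  note add_2_eq_Suc' [simp del]
  have K2: "2 \<le> K" using K by simp
  have [simp]: "\<rho> \<noteq> 0" "\<rho> \<noteq> 1" "\<rho> \<noteq> 2" "\<rho> \<noteq> 3" "0 \<noteq> \<rho>" "1 \<noteq> \<rho>" "2 \<noteq> \<rho>" "3 \<noteq> \<rho>"
    "\<rho> + 1 \<noteq> 0" "\<rho> + 1 \<noteq> 2" "\<rho> + 1 \<noteq> 3" "\<rho> + 2 \<noteq> 3" "\<rho> + 3 \<noteq> 2"
    using \<rho> by linarith+
  have [simp]: "k + 5 = Suc (Suc (Suc (Suc (Suc k))))" "k + 6 = Suc (Suc (Suc (Suc (Suc (Suc k)))))"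
    by simp_all
  note code[unfolded check_agent_def, simplified, simp]
  have [simp]: "fits K N" "fits K D" "fits K a" "fits K b" "fits K 1" "fits K (N * b)" "fits K (a * D)"
    "fits K (N * b + a * D)" "fits K (N * b + a * D + 1)"
    using bounds fits_mult_add[OF K, of N b a D]
    by (auto intro: fits_le[OF K] fits_mult[OF K] fits_small[OF K2])
  show ?thesis
  proof (cases "0 \<le> N * b + a * D")
    case True
    show ?thesis
      apply (rule exI, rule conjI, rule reach_mono)
      apply (rule reach_Mul[OF K2], simp, simp, simp, simp, simp)
      apply (rule reach_Mul[OF K2], simp, simp, simp, simp, simp)
      apply (rule reach_Add[OF K2], simp, simp, simp, simp, simp)
      apply (rule reach_Add[OF K2], simp, simp, simp, simp, simp)
      apply (rule reach_jump[OF K2], simp, simp, simp, use True in linarith)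
      apply (simp add: True, rule reach.refl[of P 0])
      apply simp_all
      done
  next
    case False
    show ?thesis
      apply (rule exI, rule conjI, rule reach_mono)
      apply (rule reach_Mul[OF K2], simp, simp, simp, simp, simp)
      apply (rule reach_Mul[OF K2], simp, simp, simp, simp, simp)
      apply (rule reach_Add[OF K2], simp, simp, simp, simp, simp)
      apply (rule reach_Add[OF K2], simp, simp, simp, simp, simp)
      apply (rule reach_no_jump[OF K2], simp, simp, simp, use False in linarith)
      apply (simp add: False, rule reach.refl[of P 0])
      apply simp_all
      done
  qed
qed

section \<open>Accumulated fractions and the growth of their entries\<close>

text \<open>
  Fractions are never reduced, so the exponent \<open>L\<close> of the bound grows with the length of the
  input that has been read.
\<close>

definition holds :: "nat \<Rightarrow> (nat \<Rightarrow> int) \<Rightarrow> nat \<Rightarrow> rat \<Rightarrow> rat \<Rightarrow> bool" where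
  "holds L X \<rho> S M \<longleftrightarrow> 0 < X (\<rho> + 1) \<and> 0 < X (\<rho> + 3) \<and>
     of_int (X \<rho>) = S * of_int (X (\<rho> + 1)) \<and> of_int (X (\<rho> + 2)) = M * of_int (X (\<rho> + 3)) \<and>
     \<bar>X \<rho>\<bar> \<le> 2 ^ L \<and> \<bar>X (\<rho> + 1)\<bar> \<le> 2 ^ L \<and> \<bar>X (\<rho> + 2)\<bar> \<le> 2 ^ L \<and> \<bar>X (\<rho> + 3)\<bar> \<le> 2 ^ L"

lemma holds_cong:
  assumes "X' \<rho> = X \<rho>" "X' (\<rho> + 1) = X (\<rho> + 1)" "X' (\<rho> + 2) = X (\<rho> + 2)" "X' (\<rho> + 3) = X (\<rho> + 3)"
  shows "holds L X' \<rho> S M \<longleftrightarrow> holds L X \<rho> S M"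
  unfolding holds_def assms ..

lemma holds_mono: "holds l X \<rho> S M \<Longrightarrow> l \<le> L \<Longrightarrow> holds L X \<rho> S M"
  unfolding holds_def using power_increasing[of l L "2 :: int"] by (meson numeral_One one_le_numeral order_trans)

definition add_item :: "rat \<times> rat \<Rightarrow> rat \<times> rat \<Rightarrow> rat \<times> rat" where
  "add_item = (\<lambda>(x, y) (S, M). if x < y then (S - x, max M x) else (S + x, M))"

lemma quotient_of_nonneg:
  assumes "0 \<le> (r :: rat)" "quotient_of r = (n, d)"
  shows "0 \<le> n" "0 < d" "of_int n = r * of_int d"
proof -
  show d: "0 < d" using quotient_of_denom_pos[OF assms(2)] .
  then show eq: "of_int n = r * of_int d" using quotient_of_div[OF assms(2)] by simp
  have "0 \<le> r * of_int d" using assms(1) d by simp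
  then show "0 \<le> n" using eq by (metis of_int_0_le_iff)
qed

lemma less_iff_cross_mult:
  fixes x y :: rat
  assumes "0 < b" "0 < d" "of_int a = x * of_int b" "of_int c = y * of_int d"
  shows "x < y \<longleftrightarrow> a * d < c * b"
proof -
  have "a * d < c * b \<longleftrightarrow> of_int a * of_int d < (of_int c * of_int b :: rat)"
    by (metis of_int_less_iff of_int_mult)
  also have "\<dots> \<longleftrightarrow> x * (of_int b * of_int d) < y * (of_int b * of_int d)"
    using assms(3,4) by (simp add: ac_simps)
  also have "\<dots> \<longleftrightarrow> x < y"
    using assms(1,2) by (simp add: mult_less_cancel_right_pos)
  finally show ?thesis by simp
qed

lemma encode_nat_bound: "int n \<le> 2 ^ length (encode_nat n)"
proof -
  have "n < 2 ^ length (binary n)" by (rule less_power_length_binary)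
  also have "\<dots> \<le> 2 ^ length (encode_nat n)" by (rule power_increasing) (auto simp: encode_nat_def)
  finally show ?thesis by (metis of_nat_le_iff of_nat_numeral of_nat_power less_imp_le)
qed

lemma encode_nat_bound_le:
  assumes "0 \<le> n" "length (encode_nat (nat n)) \<le> L"
  shows "\<bar>n\<bar> \<le> 2 ^ L"
proof -
  have "int (nat n) \<le> 2 ^ length (encode_nat (nat n))" by (rule encode_nat_bound)
  also have "\<dots> \<le> (2 :: int) ^ L" by (rule power_increasing[OF assms(2)]) simp
  finally show ?thesis using assms(1) by simp
qed

text \<open>The summands of the new numerator lie within \<open>2 ^ (l + q)\<close> and
  \<open>2 ^ (l + p)\<close>. As \<open>p\<close> and \<open>q\<close> are positive, neither
  exponent exceeds \<open>l + p + q - 1\<close>, and doubling uses up the spare digit. So exponents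
  grow by no more than the number of symbols read.\<close>

lemma item_bounds:
  fixes N D n d :: int
  assumes "\<bar>N\<bar> \<le> 2 ^ l" "\<bar>D\<bar> \<le> 2 ^ l" "\<bar>n\<bar> \<le> 2 ^ p" "\<bar>d\<bar> \<le> 2 ^ q" "1 \<le> p" "1 \<le> q"
  shows "\<bar>N * d\<bar> + \<bar>n * D\<bar> \<le> 2 ^ (l + (p + q))" "\<bar>D * d\<bar> \<le> 2 ^ (l + (p + q))"
    "\<bar>n\<bar> \<le> 2 ^ (l + (p + q))" "\<bar>d\<bar> \<le> 2 ^ (l + (p + q))" 
proof -
  have pw: "(2 :: int) ^ i \<le> 2 ^ j" if "i \<le> j" for i j :: nat
    by (rule power_increasing[OF that]) simp
  have "\<bar>N * d\<bar> \<le> 2 ^ l * 2 ^ q" "\<bar>n * D\<bar> \<le> 2 ^ l * 2 ^ p" "\<bar>D * d\<bar> \<le> 2 ^ l * 2 ^ q"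
    unfolding abs_mult using assms(1-4) mult_mono[of "\<bar>n\<bar>" "2 ^ p" "\<bar>D\<bar>" "2 ^ l"]
    by (auto intro: mult_mono simp: mult.commute)
  then have *: "\<bar>N * d\<bar> \<le> 2 ^ (l + q)" "\<bar>n * D\<bar> \<le> 2 ^ (l + p)" "\<bar>D * d\<bar> \<le> 2 ^ (l + q)"
    by (simp_all only: power_add)
  obtain e where e: "p + q = Suc e" "p \<le> e" "q \<le> e"
    using assms(5,6) by (cases "p + q") auto
  have "\<bar>N * d\<bar> \<le> 2 ^ (l + e)" "\<bar>n * D\<bar> \<le> 2 ^ (l + e)"
    using *(1,2) pw[of "l + q" "l + e"] pw[of "l + p" "l + e"] e(2,3) by (auto elim: order_trans)
  then have "\<bar>N * d\<bar> + \<bar>n * D\<bar> \<le> 2 ^ (l + e) + 2 ^ (l + e)" by (rule add_mono)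
  also have "\<dots> = 2 ^ (l + (p + q))" unfolding e(1) by simp
  finally show "\<bar>N * d\<bar> + \<bar>n * D\<bar> \<le> 2 ^ (l + (p + q))" .
  show "\<bar>D * d\<bar> \<le> 2 ^ (l + (p + q))" using *(3) by (rule order_trans) (rule pw, simp)
  show "\<bar>n\<bar> \<le> 2 ^ (l + (p + q))" using assms(3) by (rule order_trans) (rule pw, simp)
  show "\<bar>d\<bar> \<le> 2 ^ (l + (p + q))" using assms(4) by (rule order_trans) (rule pw, simp)
qed

lemma quotient_of_bounds:
  assumes "0 \<le> r" "quotient_of r = (n, d)"
  obtains p q where "\<bar>n\<bar> \<le> 2 ^ p" "\<bar>d\<bar> \<le> 2 ^ q" "1 \<le> p" "1 \<le> q" "p + q = length (encode_rat r)"
proof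
  note nd = quotient_of_nonneg[OF assms]
  show "\<bar>n\<bar> \<le> 2 ^ length (encode_nat (nat n))" "\<bar>d\<bar> \<le> 2 ^ length (encode_nat (nat d))"
    using encode_nat_bound[of "nat n"] encode_nat_bound[of "nat d"] nd by simp_all
  show "1 \<le> length (encode_nat (nat n))" "1 \<le> length (encode_nat (nat d))"
    by (simp_all add: encode_nat_def)
  show "length (encode_nat (nat n)) + length (encode_nat (nat d)) = length (encode_rat r)"
    by (simp add: encode_rat_def assms(2))
qed

text \<open>Of the two exponents, \<open>l\<close> is the current size of the fractions and grows by
  the symbols of \<open>x\<close>, while \<open>L\<close> bounds the entire run and determines the
  cost of a step. The machine's test \<open>a * d <= n * b\<close> means \<open>M <= x\<close>, so
  overwriting realises \<open>max\<close>.\<close>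

lemma update_agent_holds:
  assumes K: "2 * L + 2 \<le> K" and code: "code_at P k (update_agent k \<rho>)" and \<rho>: "5 \<le> \<rho>"
    and X: "X 0 = 0" "X 1 = 1" "X (\<rho> + 4) = n" "X (\<rho> + 5) = d" "fits K (X (\<rho> + 6))"
    and x: "0 \<le> x" "quotient_of x = (n, d)" and y: "0 < X (\<rho> + 6) \<longleftrightarrow> x < y"
    and hold: "holds l X \<rho> S M" and L: "l + length (encode_rat x) \<le> L"
  shows "\<exists>X' S' M'. reach P (13 * (K * K)) (k, X, w) (k + 13, X', w) \<and>
    add_item (x, y) (S, M) = (S', M') \<and> holds (l + length (encode_rat x)) X' \<rho> S' M' \<and>
    (\<forall>q. q \<notin> {2, 3, \<rho>, \<rho> + 1, \<rho> + 2, \<rho> + 3} \<longrightarrow> X' q = X q)"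
proof -
  define N where "N = X \<rho>"
  define D where "D = X (\<rho> + 1)"
  define a where "a = X (\<rho> + 2)"
  define b where "b = X (\<rho> + 3)"
  define c where "c = X (\<rho> + 6)"
  define l' where "l' = l + length (encode_rat x)"
  have pw: "(2 :: int) ^ i \<le> 2 ^ j" if "i \<le> j" for i j :: nat
    by (rule power_increasing[OF that]) simp
  note nd = quotient_of_nonneg[OF x]
  obtain p q where pq: "\<bar>n\<bar> \<le> 2 ^ p" "\<bar>d\<bar> \<le> 2 ^ q" "1 \<le> p" "1 \<le> q" "l' = l + (p + q)"
    using quotient_of_bounds[OF x] unfolding l'_def by metis
  have h: "0 < D" "0 < b" "of_int N = S * of_int D" "of_int a = M * of_int b"
    "\<bar>N\<bar> \<le> 2 ^ l" "\<bar>D\<bar> \<le> 2 ^ l" "\<bar>a\<bar> \<le> 2 ^ l" "\<bar>b\<bar> \<le> 2 ^ l"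
    using hold unfolding holds_def N_def D_def a_def b_def by auto
  note ib = item_bounds[OF h(5,6) pq(1-4), folded pq(5)]
  have lL: "l \<le> L" "l \<le> l'" "l' \<le> L" using L by (auto simp: l'_def)
  have bounds: "\<bar>N\<bar> \<le> 2 ^ L" "\<bar>D\<bar> \<le> 2 ^ L" "\<bar>a\<bar> \<le> 2 ^ L" "\<bar>b\<bar> \<le> 2 ^ L" "\<bar>n\<bar> \<le> 2 ^ L" "\<bar>d\<bar> \<le> 2 ^ L"
    using h(5-8) ib(3,4) pw[OF lL(1)] pw[OF lL(3)] by (blast intro: order_trans)+
  have c_iff: "0 < c \<longleftrightarrow> x < y" using y by (simp add: c_def)
  have le_iff: "a * d \<le> n * b \<longleftrightarrow> M \<le> x"
    using less_iff_cross_mult[OF nd(2) h(2) nd(3) h(4)] by (simp add: not_less[symmetric])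
  obtain X' where X': "reach P (13 * (K * K)) (k, X, w) (k + 13, X', w)"
    "X' \<rho> = (if 0 < c then N * d - n * D else N * d + n * D)" "X' (\<rho> + 1) = D * d"
    "X' (\<rho> + 2) = (if 0 < c \<and> a * d \<le> n * b then n else a)"
    "X' (\<rho> + 3) = (if 0 < c \<and> a * d \<le> n * b then d else b)"
    "\<forall>q. q \<notin> {2, 3, \<rho>, \<rho> + 1, \<rho> + 2, \<rho> + 3} \<longrightarrow> X' q = X q"
    using reach_update_agent[OF K code \<rho> X(1,2) N_def[symmetric] D_def[symmetric] a_def[symmetric]
      b_def[symmetric] X(3,4) c_def[symmetric] bounds X(5)[folded c_def], of w]
    by blast
  have absb: "\<bar>N * d - n * D\<bar> \<le> 2 ^ l'" "\<bar>N * d + n * D\<bar> \<le> 2 ^ l'"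
    using ib(1) by linarith+
  have "\<bar>X' \<rho>\<bar> \<le> 2 ^ l'" "\<bar>X' (\<rho> + 1)\<bar> \<le> 2 ^ l'" "\<bar>X' (\<rho> + 2)\<bar> \<le> 2 ^ l'" "\<bar>X' (\<rho> + 3)\<bar> \<le> 2 ^ l'"
    using absb ib(2-4) h(7,8) pw[OF lL(2)] unfolding X' by (auto elim: order_trans)
  moreover have "0 < X' (\<rho> + 1)" "0 < X' (\<rho> + 3)"
    using h(1,2) nd(2) unfolding X' by auto
  moreover obtain S' M' where SM: "add_item (x, y) (S, M) = (S', M')" by force
  moreover have "of_int (X' \<rho>) = S' * of_int (X' (\<rho> + 1))"
    using SM h(3) nd(3) c_iff unfolding X' add_item_def
    by (auto split: if_splits simp: algebra_simps)
  moreover have "of_int (X' (\<rho> + 2)) = M' * of_int (X' (\<rho> + 3))"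
    using SM h(4) nd(3) c_iff le_iff unfolding X' add_item_def
    by (auto split: if_splits simp: max_def)
  ultimately show ?thesis
    using X'(1,6) unfolding holds_def l'_def by blast
qed

section \<open>The program and one pass of its main loop\<close>

text \<open>
  The number of items still to be read is in register 4 (where it replaces the number of agents,
  which is read first and not needed); the agents occupy registers 5 to 11 and 12 to 18. The main loop
  starts at instruction 19.
\<close>

definition program :: "instr list" where
  "program =
     [SetConst 1 1, SetConst 6 1, SetConst 8 1, SetConst 13 1, SetConst 15 1] @
     read_number 5 4 @ read_number 12 4 @
     [JumpPos 4 21, JumpPos 1 81, Sub 4 4 1] @
     read_number 22 9 @ read_number 29 10 @ read_number 36 16 @ read_number 43 17 @
     [Mul 2 9 17, Mul 3 16 10, Sub 11 3 2, Sub 18 2 3] @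
     update_agent 54 5 @ update_agent 67 12 @ [JumpPos 1 19] @
     check_agent 81 5 @ check_agent 87 12 @ [Halt True]"

lemma program_code:
  "code_at program 5 (read_number 5 4)" "code_at program 12 (read_number 12 4)"
  "code_at program 22 (read_number 22 9)" "code_at program 29 (read_number 29 10)"
  "code_at program 36 (read_number 36 16)" "code_at program 43 (read_number 43 17)"
  "code_at program 54 (update_agent 54 5)" "code_at program 67 (update_agent 67 12)"
  "code_at program 81 (check_agent 81 5)" "code_at program 87 (check_agent 87 12)"
  and program_nth:
  "length program = 94"
  "program ! 0 = SetConst 1 1" "program ! 1 = SetConst 6 1" "program ! 2 = SetConst 8 1"
  "program ! 3 = SetConst 13 1" "program ! 4 = SetConst 15 1"
  "program ! 19 = JumpPos 4 21" "program ! 20 = JumpPos 1 81" "program ! 21 = Sub 4 4 1"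
  "program ! 50 = Mul 2 9 17" "program ! 51 = Mul 3 16 10" "program ! 52 = Sub 11 3 2"
  "program ! 53 = Sub 18 2 3" "program ! 80 = JumpPos 1 19"
  "program ! 86 = Halt False" "program ! 92 = Halt False" "program ! 93 = Halt True"
proof -
  have len: "length (read_number k r) = 7" "length (update_agent k r) = 13"
    "length (check_agent k r) = 6" for k r
    by (simp_all add: read_number_def update_agent_def check_agent_def)
  show "length program = 94" by (simp add: program_def len)
  note code_at_self[of program]
  then have "code_at program 0 (
     [SetConst 1 1, SetConst 6 1, SetConst 8 1, SetConst 13 1, SetConst 15 1] @
     read_number 5 4 @ read_number 12 4 @
     [JumpPos 4 21, JumpPos 1 81, Sub 4 4 1] @
     read_number 22 9 @ read_number 29 10 @ read_number 36 16 @ read_number 43 17 @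
     [Mul 2 9 17, Mul 3 16 10, Sub 11 3 2, Sub 18 2 3] @
     update_agent 54 5 @ update_agent 67 12 @ [JumpPos 1 19] @
     check_agent 81 5 @ check_agent 87 12 @ [Halt True])"
    by (simp only: program_def)
  note c = this[unfolded code_at_append len, simplified len length_append, simplified]
  have five: "Suc (Suc (Suc (Suc (Suc 0)))) = 5" by simp
  from c[unfolded five] show "code_at program 5 (read_number 5 4)"
    by blast
  from c show
    "code_at program 12 (read_number 12 4)"
    "code_at program 22 (read_number 22 9)" "code_at program 29 (read_number 29 10)"
    "code_at program 36 (read_number 36 16)" "code_at program 43 (read_number 43 17)"
    "code_at program 54 (update_agent 54 5)" "code_at program 67 (update_agent 67 12)"
    "code_at program 81 (check_agent 81 5)" "code_at program 87 (check_agent 87 12)"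
    by simp_all
  from c show
    "program ! 0 = SetConst 1 1" "program ! 19 = JumpPos 4 21" "program ! 20 = JumpPos 1 81" "program ! 21 = Sub 4 4 1"
    "program ! 50 = Mul 2 9 17" "program ! 51 = Mul 3 16 10" "program ! 52 = Sub 11 3 2"
    "program ! 53 = Sub 18 2 3" "program ! 80 = JumpPos 1 19" "program ! 93 = Halt True"
    by blast+
  have suc: "1 = Suc 0" "2 = Suc (Suc 0)" "3 = Suc (Suc (Suc 0))" "4 = Suc (Suc (Suc (Suc 0)))"
    by simp_all
  have "program ! Suc 0 = SetConst 6 1 \<and> program ! Suc (Suc 0) = SetConst 8 1 \<and>
      program ! Suc (Suc (Suc 0)) = SetConst 13 1 \<and> program ! Suc (Suc (Suc (Suc 0))) = SetConst 15 1"
    using c by blast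
  then show "program ! 1 = SetConst 6 1" "program ! 2 = SetConst 8 1" "program ! 3 = SetConst 13 1"
      "program ! 4 = SetConst 15 1"
    unfolding suc by blast+
  from c have "code_at program 81 (check_agent 81 5)" "code_at program 87 (check_agent 87 12)"
    by simp_all
  then show "program ! 86 = Halt False" "program ! 92 = Halt False"
    by (simp_all add: check_agent_def)
qed

text \<open>The instance lists utilities item by item, so the two utilities of an item are adjacent
  in the input and a single pass can compare them.\<close>

definition encode_item :: "rat \<times> rat \<Rightarrow> symbol list" where
  "encode_item xy = encode_rat (fst xy) @ encode_rat (snd xy)"

text \<open>Beyond 6 steps per symbol the pass takes 33: 2 for the loop test and the decrement, 4
  for the comparison, 13 for each agent, 1 to jump back. Each agent's exponent grows by the length
  of her own utility and is then weakened to that of the whole item, so that one exponent serves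
  both.\<close>

lemma reach_item:
  assumes K: "2 * L + 2 \<le> K"
    and X: "X 0 = 0" "X 1 = 1" "X 4 = int (Suc m)" "int (Suc m) \<le> 2 ^ L"
    and xy: "0 \<le> x" "0 \<le> y"
    and hold: "holds l X 5 S M" "holds l X 12 S' M'"
    and L: "l + length (encode_item (x, y)) \<le> L"
    and add: "add_item (x, y) (S, M) = (S1, M1)" "add_item (y, x) (S', M') = (S1', M1')"
  shows "\<exists>X'. reach program ((6 * length (encode_item (x, y)) + 33) * (K * K))
      (19, X, encode_item (x, y) @ w) (19, X', w) \<and>
    X' 0 = 0 \<and> X' 1 = 1 \<and> X' 4 = int m \<and>
    holds (l + length (encode_item (x, y))) X' 5 S1 M1 \<and>
    holds (l + length (encode_item (x, y))) X' 12 S1' M1'"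
proof -
  have K2: "2 \<le> K" using K by simp
  have pw: "(2 :: int) ^ i \<le> 2 ^ j" if "i \<le> j" for i j :: nat
    by (rule power_increasing[OF that]) simp
  obtain n1 d1 n2 d2 where q: "quotient_of x = (n1, d1)" "quotient_of y = (n2, d2)"
    by force
  note nd1 = quotient_of_nonneg[OF xy(1) q(1)] and nd2 = quotient_of_nonneg[OF xy(2) q(2)]
  have item: "encode_item (x, y) = encode_nat (nat n1) @ encode_nat (nat d1) @
      encode_nat (nat n2) @ encode_nat (nat d2)"
    by (simp add: encode_item_def encode_rat_def q)
  have eL: "length (encode_nat (nat n1)) \<le> L" "length (encode_nat (nat d1)) \<le> L"
    "length (encode_nat (nat n2)) \<le> L" "length (encode_nat (nat d2)) \<le> L"
    using L unfolding item by simp_all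
  have ints: "int (nat n1) = n1" "int (nat d1) = d1" "int (nat n2) = n2" "int (nat d2) = d2"
    using nd1 nd2 by simp_all
  have bd: "\<bar>n1\<bar> \<le> 2 ^ L" "\<bar>d1\<bar> \<le> 2 ^ L" "\<bar>n2\<bar> \<le> 2 ^ L" "\<bar>d2\<bar> \<le> 2 ^ L"
    by (rule encode_nat_bound_le[OF nd1(1) eL(1)] encode_nat_bound_le[OF less_imp_le[OF nd1(2)] eL(2)]
      encode_nat_bound_le[OF nd2(1) eL(3)] encode_nat_bound_le[OF less_imp_le[OF nd2(2)] eL(4)])+
  define X0 where "X0 = X(4 := int m)"
  have fits4: "fits K (int (Suc m))"
    using X(4) by (intro fits_le[OF K]) simp
  have R0: "reach program (K * K + (K * K + 0)) (19, X, v) (22, X0, v)" for v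
    apply (rule reach_jump[OF K2], simp add: program_nth, rule X(3), rule fits4, simp)
    apply (rule reach_Sub[OF K2], simp add: program_nth, rule X(3), rule X(2), rule fits4,
      simp add: fits_small[OF K2])
    apply (simp add: X0_def One_nat_def[symmetric] reach.refl)
    done
  let ?e1 = "encode_nat (nat n1)" and ?e2 = "encode_nat (nat d1)"
    and ?e3 = "encode_nat (nat n2)" and ?e4 = "encode_nat (nat d2)"
  have "X0 1 = 1" using X(2) by (simp add: X0_def)
  then obtain X1 where X1: "reach program (6 * length ?e1 * (K * K))
      (22, X0, ?e1 @ ?e2 @ ?e3 @ ?e4 @ w) (29, X1, ?e2 @ ?e3 @ ?e4 @ w)"
      "X1 9 = n1" "\<forall>q. q \<notin> {2, 3, 9} \<longrightarrow> X1 q = X0 q"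
    using reach_read_number[OF K program_code(3) _ _ eL(1), of X0 "?e2 @ ?e3 @ ?e4 @ w"]
    unfolding ints by auto
  with \<open>X0 1 = 1\<close> have "X1 1 = 1" by simp
  then obtain X2 where X2: "reach program (6 * length ?e2 * (K * K))
      (29, X1, ?e2 @ ?e3 @ ?e4 @ w) (36, X2, ?e3 @ ?e4 @ w)"
      "X2 10 = d1" "\<forall>q. q \<notin> {2, 3, 10} \<longrightarrow> X2 q = X1 q"
    using reach_read_number[OF K program_code(4) _ _ eL(2), of X1 "?e3 @ ?e4 @ w"]
    unfolding ints by auto
  with \<open>X1 1 = 1\<close> have "X2 1 = 1" by simp
  then obtain X3 where X3: "reach program (6 * length ?e3 * (K * K))
      (36, X2, ?e3 @ ?e4 @ w) (43, X3, ?e4 @ w)"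
      "X3 16 = n2" "\<forall>q. q \<notin> {2, 3, 16} \<longrightarrow> X3 q = X2 q"
    using reach_read_number[OF K program_code(5) _ _ eL(3), of X2 "?e4 @ w"]
    unfolding ints by auto
  with \<open>X2 1 = 1\<close> have "X3 1 = 1" by simp
  then obtain X4 where X4: "reach program (6 * length ?e4 * (K * K))
      (43, X3, ?e4 @ w) (50, X4, w)"
      "X4 17 = d2" "\<forall>q. q \<notin> {2, 3, 17} \<longrightarrow> X4 q = X3 q"
    using reach_read_number[OF K program_code(6) _ _ eL(4), of X3 w]
    unfolding ints by auto
  have X4_eqs: "X4 0 = 0" "X4 1 = 1" "X4 4 = int m" "X4 9 = n1" "X4 10 = d1" "X4 16 = n2" "X4 17 = d2"
    using X1(2,3) X2(2,3) X3(2,3) X4(2,3) X(1,2) by (simp_all add: X0_def)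
  have X4_same: "X4 q = X q" if "q \<in> {5, 6, 7, 8, 12, 13, 14, 15}" for q
    using X1(3) X2(3) X3(3) X4(3) that by (auto simp: X0_def)
  \<comment> \<open>Registers 11 and 18 receive opposite values. The positive one belongs to the
    agent who values the item strictly less; a tie makes both 0.\<close>
  define X5 where "X5 = X4(2 := n1 * d2, 3 := n2 * d1, 11 := n2 * d1 - n1 * d2, 18 := n1 * d2 - n2 * d1)"
  have fits: "fits K n1" "fits K d1" "fits K n2" "fits K d2" "fits K (n1 * d2)" "fits K (n2 * d1)"
    "fits K (n1 * d2 - n2 * d1)" "fits K (n2 * d1 - n1 * d2)"
    using bd by (auto intro: fits_le[OF K] fits_mult[OF K] fits_mult_add[OF K, THEN conjunct2, THEN conjunct2])
  have R5: "reach program (K * K + (K * K + (K * K + (K * K + 0)))) (50, X4, w) (54, X5, w)"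
    apply (rule reach_Mul[OF K2], simp add: program_nth, simp add: X4_eqs, simp add: X4_eqs, rule fits, rule fits)
    apply (rule reach_Mul[OF K2], simp add: program_nth, simp add: X4_eqs, simp add: X4_eqs, rule fits, rule fits)
    apply (rule reach_Sub[OF K2], simp add: program_nth, simp, simp, rule fits, rule fits)
    apply (rule reach_Sub[OF K2], simp add: program_nth, simp, simp, rule fits, rule fits)
    apply (simp add: X5_def reach.refl)
    done
  have xy_less: "x < y \<longleftrightarrow> n1 * d2 < n2 * d1" "y < x \<longleftrightarrow> n2 * d1 < n1 * d2"
    using less_iff_cross_mult[OF nd1(2) nd2(2) nd1(3) nd2(3)]
      less_iff_cross_mult[OF nd2(2) nd1(2) nd2(3) nd1(3)] by simp_all
  have X5: "X5 0 = 0" "X5 1 = 1" "X5 (5 + 4) = n1" "X5 (5 + 5) = d1" "X5 (5 + 6) = n2 * d1 - n1 * d2"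
    "X5 (12 + 4) = n2" "X5 (12 + 5) = d2" "X5 (12 + 6) = n1 * d2 - n2 * d1" "X5 4 = int m"
    by (simp_all add: X5_def X4_eqs)
  have hold5: "holds l X5 5 S M" "holds l X5 12 S' M'"
    using hold holds_cong[of X5 5 X] holds_cong[of X5 12 X] by (simp_all add: X5_def X4_same)
  let ?l = "l + length (encode_item (x, y))"
  have lens: "l + length (encode_rat x) \<le> ?l" "l + length (encode_rat y) \<le> ?l"
    by (simp_all add: encode_item_def)
  note lensL = lens[THEN order_trans, OF L]
  have "fits K (X5 (5 + 6))" "0 < X5 (5 + 6) \<longleftrightarrow> x < y"
    unfolding X5 xy_less by (rule fits) simp
  from update_agent_holds[OF K program_code(7) _ X5(1-4) this(1) xy(1) q(1) this(2) hold5(1) lensL(1), of w]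
  obtain X6 where X6: "reach program (13 * (K * K)) (54, X5, w) (67, X6, w)"
    "holds (l + length (encode_rat x)) X6 5 S1 M1"
    "\<forall>q. q \<notin> {2, 3, 5, 5 + 1, 5 + 2, 5 + 3} \<longrightarrow> X6 q = X5 q"
    using add(1) by auto
  have same: "X6 q = X5 q" if "q \<notin> {2, 3, 5, 6, 7, 8}" for q
    using X6(3) that by simp
  have X6s: "X6 0 = 0" "X6 1 = 1" "X6 (12 + 4) = n2" "X6 (12 + 5) = d2" "X6 4 = int m"
    using X5 by (simp_all add: same)
  have hold6: "holds l X6 12 S' M'"
    using hold5(2) holds_cong[of X6 12 X5] by (simp add: same)
  have "X6 (12 + 6) = X5 (12 + 6)" by (simp add: same)
  then have "fits K (X6 (12 + 6))" "0 < X6 (12 + 6) \<longleftrightarrow> y < x"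
    unfolding X5 xy_less by (simp_all add: fits)
  from update_agent_holds[OF K program_code(8) _ X6s(1-4) this(1) xy(2) q(2) this(2) hold6 lensL(2), of w]
  obtain X7 where X7: "reach program (13 * (K * K)) (67, X6, w) (80, X7, w)"
    "holds (l + length (encode_rat y)) X7 12 S1' M1'"
    "\<forall>q. q \<notin> {2, 3, 12, 12 + 1, 12 + 2, 12 + 3} \<longrightarrow> X7 q = X6 q"
    using add(2) by auto
  have same7: "X7 q = X6 q" if "q \<notin> {2, 3, 12, 13, 14, 15}" for q
    using X7(3) that by simp
  have X7s: "X7 0 = 0" "X7 1 = 1" "X7 4 = int m"
    using X6s by (simp_all add: same7)
  have hold7: "holds ?l X7 5 S1 M1" "holds ?l X7 12 S1' M1'"
    using holds_mono[OF X6(2) lens(1)] holds_mono[OF X7(2) lens(2)] holds_cong[of X7 5 X6]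
    by (simp_all add: same7)
  have R8: "reach program (K * K + 0) (80, X7, w) (19, X7, w)"
    by (rule reach_jump[OF K2], simp add: program_nth, rule X7s, simp_all add: fits_small[OF K2] reach.refl)
  note R = reach_trans[OF R0 reach_trans[OF X1(1) reach_trans[OF X2(1) reach_trans[OF X3(1)
    reach_trans[OF X4(1) reach_trans[OF R5 reach_trans[OF X6(1) reach_trans[OF X7(1) R8]]]]]]]]
  have "reach program ((6 * length (encode_item (x, y)) + 33) * (K * K))
      (19, X, encode_item (x, y) @ w) (19, X7, w)"
    using reach_mono[OF R] by (simp add: item algebra_simps)
  then show ?thesis
    using X7s hold7 by blast
qed

definition encode_items :: "(rat \<times> rat) list \<Rightarrow> symbol list" where
  "encode_items rs = concat (map encode_item rs)"

text \<open>The item count is written in binary, so a loop over the items could be exponential in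
  the length of the count alone; but each item occupies input of its own.\<close>

lemma length_le_encode_items: "length rs \<le> length (encode_items rs)"
  by (induction rs) (auto simp: encode_items_def encode_item_def encode_rat_def encode_nat_def)

text \<open>The second agent sees the same pairs swapped. The exponent \<open>l\<close> absorbs the
  length of each item read, so \<open>l\<close> plus the unread length stays within
  \<open>L\<close>. The 2 extra steps are the failed loop test and the jump to the checks.\<close>

lemma reach_items:
  assumes K: "2 * L + 2 \<le> K"
    and "X 0 = 0" "X 1 = 1" "X 4 = int (length rs)"
    and "\<forall>(x, y)\<in>set rs. 0 \<le> x \<and> 0 \<le> y"
    and "holds l X 5 S M" "holds l X 12 S' M'" "l + length (encode_items rs) \<le> L"
    and "fold add_item rs (S, M) = (S1, M1)"
    and "fold add_item (map prod.swap rs) (S', M') = (S1', M1')"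
  shows "\<exists>X'. reach program ((6 * length (encode_items rs) + 33 * length rs + 2) * (K * K))
      (19, X, encode_items rs) (81, X', []) \<and> X' 1 = 1 \<and> holds L X' 5 S1 M1 \<and> holds L X' 12 S1' M1'"
  using assms(2-)
proof (induction rs arbitrary: X l S M S' M')
  have K2: "2 \<le> K" using K by simp
  {
    case Nil
    have "reach program (K * K + (K * K + 0)) (19, X, []) (81, X, [])"
      apply (rule reach_no_jump[OF K2], simp add: program_nth, simp add: Nil, simp add: fits_small[OF K2], simp)
      apply (rule reach_jump[OF K2], simp add: program_nth, simp add: Nil, simp add: fits_small[OF K2], simp)
      apply (rule reach.refl)
      done
    then have "reach program ((6 * length (encode_items []) + 33 * length ([] :: (rat \<times> rat) list) + 2) * (K * K))
        (19, X, encode_items []) (81, X, [])"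
      by (simp add: encode_items_def mult_2)
    then show ?case
      using Nil holds_mono[of l X 5 S M L] holds_mono[of l X 12 S' M' L] by auto
  next
    case (Cons r rs)
    obtain x y where r: "r = (x, y)" by force
    obtain S2 M2 where fst: "add_item (x, y) (S, M) = (S2, M2)" by force
    obtain S2' M2' where snd: "add_item (y, x) (S', M') = (S2', M2')" by force
    have enc: "encode_items (r # rs) = encode_item (x, y) @ encode_items rs"
      by (simp add: encode_items_def r)
    have "int (Suc (length rs)) \<le> 2 ^ L"
    proof -
      \<comment> \<open>The item counter must fit as well: it is at most the input length, hence
        below \<open>2 ^ L\<close>.\<close>
      have "Suc (length rs) \<le> L"
        using length_le_encode_items[of "r # rs"] Cons.prems(7) by simp
      also have "L \<le> 2 ^ L" by (rule less_imp_le[OF less_exp])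
      finally have "int (Suc (length rs)) \<le> int (2 ^ L)" by (simp only: of_nat_le_iff)
      then show ?thesis by simp
    qed
    moreover have "l + length (encode_item (x, y)) \<le> L"
      using Cons.prems(7) by (simp add: enc)
    ultimately obtain X1 where X1: "reach program ((6 * length (encode_item (x, y)) + 33) * (K * K))
        (19, X, encode_item (x, y) @ encode_items rs) (19, X1, encode_items rs)"
      "X1 0 = 0" "X1 1 = 1" "X1 4 = int (length rs)"
      "holds (l + length (encode_item (x, y))) X1 5 S2 M2"
      "holds (l + length (encode_item (x, y))) X1 12 S2' M2'"
      using reach_item[OF K Cons.prems(1,2) _ _ _ _ Cons.prems(5,6) _ fst snd, of "length rs" "encode_items rs"]
        Cons.prems(3,4) by (auto simp: r)
    have nonneg: "\<forall>(x, y)\<in>set rs. 0 \<le> x \<and> 0 \<le> y"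
      using Cons.prems(4) by simp
    have len: "l + length (encode_item (x, y)) + length (encode_items rs) \<le> L"
      using Cons.prems(7) by (simp add: enc)
    have folds: "fold add_item rs (S2, M2) = (S1, M1)"
      "fold add_item (map prod.swap rs) (S2', M2') = (S1', M1')"
      using Cons.prems(8,9) by (simp_all add: r fst snd)
    obtain X2 where X2: "reach program ((6 * length (encode_items rs) + 33 * length rs + 2) * (K * K))
        (19, X1, encode_items rs) (81, X2, [])" "X2 1 = 1" "holds L X2 5 S1 M1" "holds L X2 12 S1' M1'"
      using Cons.IH[OF X1(2-4) nonneg X1(5,6) len folds] by blast
    have "reach program ((6 * length (encode_items (r # rs)) + 33 * length (r # rs) + 2) * (K * K))
        (19, X, encode_items (r # rs)) (81, X2, [])"
      using reach_mono[OF reach_trans[OF X1(1) X2(1)]] by (simp add: enc algebra_simps)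
    then show ?case using X2(2-4) by blast
  }
qed

section \<open>The whole run and its cost\<close>

lemma check_agent_holds:
  assumes K: "2 * L + 2 \<le> K" and code: "code_at P k (check_agent k \<rho>)" and \<rho>: "5 \<le> \<rho>"
    and X: "X 1 = 1" and hold: "holds L X \<rho> S M"
  shows "\<exists>X'. reach P (5 * (K * K)) (k, X, w) (if 0 \<le> S + M then k + 6 else k + 5, X', w) \<and>
    (\<forall>q. q \<notin> {2, 3} \<longrightarrow> X' q = X q)"
proof -
  define N where "N = X \<rho>"
  define D where "D = X (\<rho> + 1)"
  define a where "a = X (\<rho> + 2)"
  define b where "b = X (\<rho> + 3)"
  have h: "0 < D" "0 < b" "of_int N = S * of_int D" "of_int a = M * of_int b"
    "\<bar>N\<bar> \<le> 2 ^ L" "\<bar>D\<bar> \<le> 2 ^ L" "\<bar>a\<bar> \<le> 2 ^ L" "\<bar>b\<bar> \<le> 2 ^ L"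
    using hold unfolding holds_def N_def D_def a_def b_def by auto
  have "rat_of_int (N * b + a * D) = (S + M) * (of_int D * of_int b)"
    using h(3,4) by (simp add: algebra_simps)
  moreover have "0 < rat_of_int D * of_int b" using h(1,2) by simp
  ultimately have "0 \<le> N * b + a * D \<longleftrightarrow> 0 \<le> S + M"
    by (metis of_int_0_le_iff zero_le_mult_iff not_less order_less_imp_le)
  then show ?thesis
    using reach_check_agent[OF K code \<rho> X N_def[symmetric] D_def[symmetric] a_def[symmetric]
      b_def[symmetric] h(5-8), of w] by simp
qed

lemma run_program:
  assumes "\<forall>(x, y)\<in>set rs. 0 \<le> x \<and> 0 \<le> y"
    and w: "w = encode_nat k @ encode_nat (length rs) @ encode_items rs"
    and "fold add_item rs (0, 0) = (S, M)"
    and "fold add_item (map prod.swap rs) (0, 0) = (S', M')"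
  defines "K \<equiv> 2 * length w + 2"
  shows "\<exists>t \<le> Suc ((39 * length w + 17) * (K * K)).
    run program (initial_config w) (0 \<le> S + M \<and> 0 \<le> S' + M') t"
proof -
  define L where "L = length w"
  have K: "2 * L + 2 \<le> K" by (simp add: K_def L_def)
  have K2: "2 \<le> K" using K by simp
  \<comment> \<open>Register 1 gets its constant, and registers 6, 8, 13 and 15 are the denominators
    of the sums and maxima: every accumulated fraction starts as 0 / 1.\<close>
  define X0 :: "nat \<Rightarrow> int" where "X0 = (\<lambda>_. 0)(1 := 1, 6 := 1, 8 := 1, 13 := 1, 15 := 1)"
  have R0: "reach program (K * K + (K * K + (K * K + (K * K + (K * K + 0))))) (initial_config w) (5, X0, w)"
    unfolding initial_config_def
    apply (rule reach_SetConst[OF K2], simp add: program_nth One_nat_def[symmetric], simp add: fits_small[OF K2])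
    apply (rule reach_SetConst[OF K2], simp add: program_nth One_nat_def[symmetric], simp add: fits_small[OF K2])
    apply (rule reach_SetConst[OF K2], simp add: program_nth One_nat_def[symmetric], simp add: fits_small[OF K2])
    apply (rule reach_SetConst[OF K2], simp add: program_nth One_nat_def[symmetric], simp add: fits_small[OF K2])
    apply (rule reach_SetConst[OF K2], simp add: program_nth One_nat_def[symmetric], simp add: fits_small[OF K2])
    apply (simp add: X0_def One_nat_def[symmetric] reach.refl)
    done
  let ?e1 = "encode_nat k" and ?e2 = "encode_nat (length rs)"
  have eL: "length ?e1 \<le> L" "length ?e2 \<le> L" by (simp_all add: L_def w)
  have "X0 1 = 1" by (simp add: X0_def)
  then obtain X1 where X1: "reach program (6 * length ?e1 * (K * K)) (5, X0, w) (12, X1, ?e2 @ encode_items rs)"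
      "\<forall>q. q \<notin> {2, 3, 4} \<longrightarrow> X1 q = X0 q"
    using reach_read_number[OF K program_code(1) _ _ eL(1), of X0 "?e2 @ encode_items rs"]
    unfolding w by auto
  have "X1 1 = 1" using X1(2) by (simp add: X0_def)
  then obtain X2 where X2: "reach program (6 * length ?e2 * (K * K)) (12, X1, ?e2 @ encode_items rs)
      (19, X2, encode_items rs)"
      "X2 4 = int (length rs)" "\<forall>q. q \<notin> {2, 3, 4} \<longrightarrow> X2 q = X1 q"
    using reach_read_number[OF K program_code(2) _ _ eL(2), of X1 "encode_items rs"] by auto
  have X2s: "X2 q = X0 q" if "q \<notin> {2, 3, 4}" for q
    using X1(2) X2(3) that by simp
  have X2_01: "X2 0 = 0" "X2 1 = 1" by (simp_all add: X2s) (simp_all add: X0_def)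
  \<comment> \<open>The entries 0 and 1 are within \<open>2 ^ 0\<close>, so the exponent starts at
    0.\<close>
  have X2_holds: "holds 0 X2 5 0 0" "holds 0 X2 12 0 0"
    unfolding holds_def by (simp_all add: X2s) (simp_all add: X0_def)
  have len: "0 + length (encode_items rs) \<le> L" by (simp add: L_def w)
  obtain X3 where X3:
    "reach program ((6 * length (encode_items rs) + 33 * length rs + 2) * (K * K))
      (19, X2, encode_items rs) (81, X3, [])" "X3 1 = 1" "holds L X3 5 S M" "holds L X3 12 S' M'"
    using reach_items[OF K X2_01 X2(2) assms(1) X2_holds len assms(3,4)] by blast
  note R3 = reach_trans[OF R0 reach_trans[OF X1(1) reach_trans[OF X2(1) X3(1)]]]
  have pcs: "81 + 6 = (87 :: nat)" "81 + 5 = (86 :: nat)" "87 + 6 = (93 :: nat)" "87 + 5 = (92 :: nat)"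
    by simp_all
  obtain X4 where X4: "reach program (5 * (K * K)) (81, X3, []) (if 0 \<le> S + M then 87 else 86, X4, [])"
    "\<forall>q. q \<notin> {2, 3} \<longrightarrow> X4 q = X3 q"
    using check_agent_holds[OF K program_code(9) _ X3(2,3), of "[]", unfolded pcs] by blast
  have "X4 1 = 1" "holds L X4 12 S' M'"
    using X3(2,4) X4(2) holds_cong[of X4 12 X3] by simp_all
  then obtain X5 where X5: "reach program (5 * (K * K)) (87, X4, []) (if 0 \<le> S' + M' then 93 else 92, X5, [])"
    using check_agent_holds[OF K program_code(10), of X4 S' M' "[]", unfolded pcs] by auto
  note R4 = reach_trans[OF R3 X4(1)]
  have "\<exists>pc X. reach program ((39 * length w + 17) * (K * K)) (initial_config w) (pc, X, []) \<and>
    pc < length program \<and> program ! pc = Halt (0 \<le> S + M \<and> 0 \<le> S' + M')"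
  proof -
    \<comment> \<open>5 steps for the constants, 6 per symbol, 33 per item, 2 to leave the loop and
      5 for each check. The item count is at most the input length, hence 39 = 6 + 33 and 17 = 5 + 2
      + 10.\<close>
    have le: "5 + 6 * length ?e1 + 6 * length ?e2 + (6 * length (encode_items rs) + 33 * length rs + 2) + 10
        \<le> 39 * length w + 17"
      using length_le_encode_items[of rs] by (simp add: w)
    note bound = mult_le_mono1[OF le, of "K * K"]
    show ?thesis
    proof (cases "0 \<le> S + M")
      case True
      then have "reach program (5 * (K * K)) (81, X3, []) (87, X4, [])" using X4(1) by simp
      note R5 = reach_trans[OF R3 reach_trans[OF this X5]]
      have "reach program ((39 * length w + 17) * (K * K)) (initial_config w)
          (if 0 \<le> S' + M' then 93 else 92, X5, [])"
        by (rule reach_mono[OF R5 order_trans[OF _ bound]]) (simp add: algebra_simps)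
      then show ?thesis
        using True by (cases "0 \<le> S' + M'") (auto simp: program_nth intro!: exI)
    next
      \<comment> \<open>A failed first check ends the run at address 86, before the second
        check.\<close>
      case False
      have "reach program ((39 * length w + 17) * (K * K)) (initial_config w)
          (if 0 \<le> S + M then 87 else 86, X4, [])"
        by (rule reach_mono[OF R4 order_trans[OF _ bound]]) (simp add: algebra_simps)
      then show ?thesis
        using False by (auto simp: program_nth intro!: exI)
    qed
  qed
  then show ?thesis using reach_run by blast
qed

section \<open>Correctness of the decision\<close>

text \<open>The maximum is described through threshold tests, where \<open>max\<close> becomes a
  disjunction. Keeping \<open>T\<close> free allows it to be set to the final sum.\<close>

lemma fold_add_item:
  assumes "fold add_item rs (S, M) = (S1, M1)"
  shows "S1 = S + (\<Sum>(x, y)\<leftarrow>rs. if x < y then - x else x)"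
    and "0 \<le> T + M1 \<longleftrightarrow> 0 \<le> T + M \<or> (\<exists>(x, y)\<in>set rs. x < y \<and> 0 \<le> T + x)"
proof -
  have "S1 = S + (\<Sum>(x, y)\<leftarrow>rs. if x < y then - x else x) \<and>
    (0 \<le> T + M1 \<longleftrightarrow> 0 \<le> T + M \<or> (\<exists>(x, y)\<in>set rs. x < y \<and> 0 \<le> T + x))"
    using assms
  proof (induction rs arbitrary: S M)
    case (Cons r rs)
    obtain x y where r: "r = (x, y)" by force
    show ?case
    proof (cases "x < y")
      case True
      have "0 \<le> T + max M x \<longleftrightarrow> 0 \<le> T + M \<or> 0 \<le> T + x" by (auto simp: max_def)
      then show ?thesis
        using Cons.IH[of "S - x" "max M x"] Cons.prems True by (auto simp: r add_item_def)
    next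
      case False
      then show ?thesis
        using Cons.IH[of "S + x" M] Cons.prems by (auto simp: r add_item_def)
    qed
  qed simp
  then show "S1 = S + (\<Sum>(x, y)\<leftarrow>rs. if x < y then - x else x)"
    and "0 \<le> T + M1 \<longleftrightarrow> 0 \<le> T + M \<or> (\<exists>(x, y)\<in>set rs. x < y \<and> 0 \<le> T + x)"
    by blast+
qed

text \<open>Carries the criterion from real utilities to the rational accumulation; the embedding
  preserves sums and order.\<close>

lemma content_iff_fold:
  assumes "fold add_item (map (\<lambda>x. (u x, v x)) [1..<Suc m]) (0, 0) = (S, M)"
  shows "content (\<lambda>x. real_of_rat (u x)) (\<lambda>x. real_of_rat (v x)) {1..m} \<longleftrightarrow> 0 \<le> S + M"
proof -
  have "S = (\<Sum>x\<leftarrow>[1..<Suc m]. if u x < v x then - u x else u x)"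
    using fold_add_item(1)[OF assms] by (simp add: comp_def del: upt_Suc)
  also have "\<dots> = (\<Sum>x\<in>{1..m}. if u x < v x then - u x else u x)"
    by (subst interv_sum_list_conv_sum_set_nat) (simp only: set_upt atLeastLessThanSuc_atLeastAtMost)
  finally have "real_of_rat S = (\<Sum>x\<in>{1..m}. real_of_rat (if u x < v x then - u x else u x))"
    by (simp add: of_rat_sum)
  also have "\<dots> = (\<Sum>x\<in>{1..m}. if real_of_rat (u x) < real_of_rat (v x) then - real_of_rat (u x) else real_of_rat (u x))"
    by (intro sum.cong) (auto simp: of_rat_less of_rat_minus)
  finally have S: "(\<Sum>x\<in>{1..m}. if real_of_rat (u x) < real_of_rat (v x) then - real_of_rat (u x)
      else real_of_rat (u x)) = real_of_rat S" ..
  have "content (\<lambda>x. real_of_rat (u x)) (\<lambda>x. real_of_rat (v x)) {1..m} \<longleftrightarrow>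
      0 \<le> real_of_rat S \<or> (\<exists>x\<in>{1..m}. real_of_rat (u x) < real_of_rat (v x) \<and>
        0 \<le> real_of_rat S + real_of_rat (u x))"
    by (simp only: content_iff[OF finite_atLeastAtMost] S)
  also have "\<dots> \<longleftrightarrow> 0 \<le> S \<or> (\<exists>x\<in>{1..m}. u x < v x \<and> 0 \<le> S + u x)"
    by (simp add: of_rat_less flip: of_rat_add)
  \<comment> \<open>With \<open>T\<close> taken to be \<open>S\<close>, the initial maximum 0
    accounts for the disjunct \<open>0 <= S\<close>.\<close>
  also have "\<dots> \<longleftrightarrow> 0 \<le> S + M"
    unfolding fold_add_item(2)[OF assms] by (auto simp del: upt_Suc)
  finally show ?thesis .
qed

theorem theorem6p1:
  "polynomial_time_decidable encode_instance
     {I :: allocation_instance. valid_instance I \<and> num_agents I = 2}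
     exists_UM_and_EF1"
proof -
  \<comment> \<open>The bound of \<open>run_program\<close> in the input length \<open>w\<close>: 1
    for the halt and \<open>17 + 39 * w\<close> steps of cost at most \<open>(2 * w + 2) ^ 2\<close>
    each.\<close>
  define r :: "nat poly" where "r = 1 + [:17, 39:] * [:2, 2:] ^ 2"
  have "\<exists>t. run program (initial_config (encode_instance I)) (exists_UM_and_EF1 I) t \<and>
      t \<le> poly r (length (encode_instance I))"
    if I: "valid_instance I" "num_agents I = 2" for I
  proof -
    define m where "m = num_items I"
    define rs where "rs = map (\<lambda>x. (utility I 1 x, utility I 2 x)) [1..<Suc m]"
    have agents: "[1..<Suc 2] = [1, 2 :: nat]" by (simp add: upt_rec)
    \<comment> \<open>Regroups the flat list of encoded utilities into one block per item.\<close>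
    have "concat (concat (map (\<lambda>x. [f x, g x]) xs)) = concat (map (\<lambda>x. f x @ g x) xs)"
      for f g :: "nat \<Rightarrow> symbol list" and xs
      by (induction xs) auto
    then have w: "encode_instance I = encode_nat 2 @ encode_nat (length rs) @ encode_items rs"
      unfolding encode_instance_def I(2) agents rs_def encode_items_def
      by (simp add: encode_item_def m_def comp_def del: upt_Suc)
    have nonneg: "0 \<le> utility I i x" if "i \<in> {1..2}" "x \<in> {1..m}" for i x
      using I that unfolding valid_instance_def agents_def items_def m_def by auto
    then have rs: "\<forall>(x, y)\<in>set rs. 0 \<le> x \<and> 0 \<le> y"
      unfolding rs_def by auto
    obtain S M where SM: "fold add_item rs (0, 0) = (S, M)" by force
    obtain S' M' where SM': "fold add_item (map prod.swap rs) (0, 0) = (S', M')" by force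
    have "exists_UM_and_EF1 I \<longleftrightarrow> content (real_utility I 1) (real_utility I 2) {1..m} \<and>
        content (real_utility I 2) (real_utility I 1) {1..m}"
      unfolding exists_UM_and_EF1_def agents_def items_def I(2) m_def[symmetric]
      by (rule exists_UM_and_EF1_two) (auto simp: real_utility_def nonneg)
    also have "\<dots> \<longleftrightarrow> 0 \<le> S + M \<and> 0 \<le> S' + M'"
      using content_iff_fold[OF SM[unfolded rs_def]]
        content_iff_fold[of "utility I 2" "utility I 1" m S' M'] SM'
      by (simp add: real_utility_def[abs_def] rs_def comp_def del: upt_Suc)
    finally show ?thesis
      using run_program[OF rs w SM SM'] by (auto simp: r_def power2_eq_square algebra_simps)
  qed
  then show ?thesis
    unfolding polynomial_time_decidable_def by blast
qed

end
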